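(* Let $(X,R)$ be an AF equivalence relation with $X$ compact, and let $A$ be a locally compact group. \begin{enumerate} \item There exist a Bratteli diagram, with infinite path space $\underline X$ and tail equivalence relation $\underline R$ on $\underline X$, and a homeomorphism $\varphi:X\rightarrow\underline X$ carrying $R$ into $\underline R$ (that is, $(\varphi\times\varphi)(R)=\underline R$). \item If moreover $c\in Z^1(R,A)$ is a continuous cocycle taking finitely many values on each $R_n$ of an increasing sequence $(R_n)$ of proper equivalence relations on $X$ such that $R=\bigcup_n R_n$, then the Bratteli diagram and $\varphi$ can be chosen such that $\varphi$ carries $c$ into a quasi-product cocycle (that is, $c\circ(\varphi\times\varphi)^{-1}:\underline R\to A$ is a quasi-product cocycle relative to this Bratteli diagram). \item Given an increasing sequence $(R_n)$ of proper equivalence relations on $X$ such that $R=\bigcup_n R_n$, every continuous cocycle $c\in Z^1(R,A)$ is continuously cohomologous to a continuous cocycle taking finitely many values on each $R_n$. \end{enumerate}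
   Context: $X$ is a locally compact second countable Hausdorff space and $R$ is an equivalence relation on $X$ with countable classes; $R\subset X\times X$ also denotes its graph, and $r,s:R\to X$ are the first and second projections. $R$ is \emph{proper} if its graph is closed in $X\times X$ and the quotient map $X\to X/R$ is a local homeomorphism. $R$ is \emph{approximately proper} (AP) if $R=\bigcup_n R_n$ for an increasing sequence $(R_n)$ of proper equivalence relations on $X$. $R$ is \emph{approximately finite} (AF) if it is AP and $X$ is totally disconnected. An AP equivalence relation $R=\bigcup_n R_n$ is equipped with the inductive limit topology (each $R_n$ carrying the topology of a subspace of $X\times X$), which makes it an étale locally compact Hausdorff groupoid. This topology is part of the structure of $(X,R)$: continuity of cocycles on $R$ refers to it, and the sequences $(R_n)$ with $R=\bigcup_n R_n$ in (2) and (3) are understood to be sequences defining this topology. $Z^1(R,A)$ is the set of cocycles $c:R\to A$, i.e. maps with $c(x,y)c(y,z)=c(x,z)$ whenever $(x,y),(y,z)\in R$. Two continuous cocycles $c,c'$ are continuously cohomologous if there is a continuous $\psi:X\to A$ with $c'(x,y)=\psi(x)c(x,y)\psi(y)^{-1}$ for all $(x,y)\in R$. A \emph{Bratteli diagram} $(V,E)$ is an oriented graph whose vertices are stacked on levels $n=0,1,2,\ldots$ and whose edges run from a vertex of level $n-1$ to a vertex of level $n$; $V(n)$ is the set of vertices of level $n$ and $E(n)$ ($n\ge1$) the set of edges from level $n-1$ to level $n$; for every vertex $v$ there are finitely many, but at least one, edges starting from $v$. An infinite path is a sequence of connected edges $x=x_1x_2\ldots$ with $x_n\in E(n)$ ($x_1$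 starts at level $0$). The infinite path space has the totally disconnected topology with basis the cylinder sets $Z(x_1\ldots x_n)$ (all infinite paths beginning with $x_1\ldots x_n$). The tail equivalence relation on it is: $x\sim y$ iff there is $N$ with $x_n=y_n$ for all $n> N$. A cocycle $c:\underline R\to A$ on the tail equivalence relation is a \emph{quasi-product cocycle} relative to $(V,E)$ if there is a map $f:E\to A$, with restriction $f_n$ to $E(n)$, such that $$c(x,y)=\lim_{n\to\infty} f_1(x_1)f_2(x_2)\cdots f_n(x_n)[f_n(y_n)]^{-1}\cdots[f_2(y_2)]^{-1}[f_1(y_1)]^{-1}$$ (the sequence is eventually constant).
   Formalization: Part (3) is stated only for locally compact groups A that are first countable (equivalently metrizable); it fails for some non-metrizable compact groups, such as a suitable uncountable power of {+1,-1}. Parts (1) and (2) are for all locally compact Hausdorff groups A. *)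

theory Defs
  imports "HOL-Analysis.Analysis" "HOL-Algebra.Group" "Graph_Theory.Digraph"
begin

section \<open>Topological preliminaries\<close>

definition totally_disconnected_space :: "'a topology \<Rightarrow> bool" where
  "totally_disconnected_space X \<longleftrightarrow> (\<forall>C. connectedin X C \<longrightarrow> (\<exists>a. C \<subseteq> {a}))"

definition quotient_topology :: "'a topology \<Rightarrow> ('a \<Rightarrow> 'b) \<Rightarrow> 'b topology" where
  "quotient_topology X f =
     topology (\<lambda>U. U \<subseteq> f ` topspace X \<and> openin X {x \<in> topspace X. f x \<in> U})"

lemma openin_quotient_topology:
  "openin (quotient_topology X f) U \<longleftrightarrow>
     U \<subseteq> f ` topspace X \<and> openin X {x \<in> topspace X. f x \<in> U}"
proof -
  have 1: "{x \<in> topspace X. f x \<in> S \<inter> T} =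
      {x \<in> topspace X. f x \<in> S} \<inter> {x \<in> topspace X. f x \<in> T}" for S T
    by auto
  have 2: "{x \<in> topspace X. f x \<in> \<Union>K} = (\<Union>S\<in>K. {x \<in> topspace X. f x \<in> S})" for K
    by auto
  have "istopology (\<lambda>U. U \<subseteq> f ` topspace X \<and> openin X {x \<in> topspace X. f x \<in> U})"
    unfolding istopology_def 1 2 by (auto intro!: openin_Int openin_Union)
  then show ?thesis
    by (simp add: quotient_topology_def)
qed

lemma quotient_map_quotient_topology: "quotient_map X (quotient_topology X f) f"
proof -
  have "{x \<in> topspace X. f x \<in> f ` topspace X} = topspace X"
    by auto
  then have "openin (quotient_topology X f) (f ` topspace X)"
    by (simp add: openin_quotient_topology)
  then have "topspace (quotient_topology X f) = f ` topspace X"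
    by (meson openin_quotient_topology openin_subset openin_topspace subset_antisym)
  then show ?thesis
    by (auto simp: quotient_map_def openin_quotient_topology)
qed

definition local_homeomorphism :: "'a topology \<Rightarrow> 'b topology \<Rightarrow> ('a \<Rightarrow> 'b) \<Rightarrow> bool" where
  "local_homeomorphism X Y f \<longleftrightarrow>
     (\<forall>x \<in> topspace X. \<exists>U. openin X U \<and> x \<in> U \<and> openin Y (f ` U) \<and>
        homeomorphic_map (subtopology X U) (subtopology Y (f ` U)) f)"

section \<open>Proper, AP and AF equivalence relations\<close>

definition countable_equivalence :: "'a topology \<Rightarrow> ('a \<times> 'a) set \<Rightarrow> bool" where
  "countable_equivalence X R \<longleftrightarrow>
     equiv (topspace X) R \<and> (\<forall>x \<in> topspace X. countable (R `` {x}))"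

definition proper_equivalence :: "'a topology \<Rightarrow> ('a \<times> 'a) set \<Rightarrow> bool" where
  "proper_equivalence X R \<longleftrightarrow>
     countable_equivalence X R \<and>
     closedin (prod_topology X X) R \<and>
     local_homeomorphism X (quotient_topology X (\<lambda>x. R `` {x})) (\<lambda>x. R `` {x})"

definition inductive_limit_topology ::
    "'a topology \<Rightarrow> (nat \<Rightarrow> ('a \<times> 'a) set) \<Rightarrow> ('a \<times> 'a) topology" where
  "inductive_limit_topology X Rs =
     topology (\<lambda>U. U \<subseteq> (\<Union>n. Rs n) \<and>
       (\<forall>n. openin (subtopology (prod_topology X X) (Rs n)) (U \<inter> Rs n)))"

lemma openin_inductive_limit_topology:
  "openin (inductive_limit_topology X Rs) U \<longleftrightarrow>
     U \<subseteq> (\<Union>n. Rs n) \<and>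
     (\<forall>n. openin (subtopology (prod_topology X X) (Rs n)) (U \<inter> Rs n))"
proof -
  have 1: "S \<inter> T \<inter> A = (S \<inter> A) \<inter> (T \<inter> A)" for S T A :: "('a \<times> 'a) set"
    by auto
  have "istopology (\<lambda>U. U \<subseteq> (\<Union>n. Rs n) \<and>
       (\<forall>n. openin (subtopology (prod_topology X X) (Rs n)) (U \<inter> Rs n)))"
    unfolding istopology_def
  proof (intro conjI allI impI, goal_cases)
    case (2 S T n)
    then show ?case by (subst 1) (blast intro: openin_Int)
  next
    case (4 K n)
    have eq: "\<Union>K \<inter> Rs n = (\<Union>S\<in>K. S \<inter> Rs n)" by auto
    show ?case unfolding eq by (rule openin_Union) (use 4 in blast)
  qed auto
  then show ?thesis
    by (simp add: inductive_limit_topology_def)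
qed

text \<open>An AP equivalence relation is a triple: the space \<open>X\<close>, the relation \<open>R\<close>, and the
  topology \<open>\<tau>\<close> of \<open>R\<close>, which is part of the structure.  A defining sequence must recover
  both \<open>R\<close> and \<open>\<tau>\<close>.\<close>

definition defining_sequence ::
    "'a topology \<Rightarrow> ('a \<times> 'a) set \<Rightarrow> ('a \<times> 'a) topology \<Rightarrow> (nat \<Rightarrow> ('a \<times> 'a) set) \<Rightarrow> bool" where
  "defining_sequence X R \<tau> Rs \<longleftrightarrow>
     (\<forall>n. proper_equivalence X (Rs n)) \<and> incseq Rs \<and> R = (\<Union>n. Rs n) \<and>
     \<tau> = inductive_limit_topology X Rs"

definition AP_equivalence ::
    "'a topology \<Rightarrow> ('a \<times> 'a) set \<Rightarrow> ('a \<times> 'a) topology \<Rightarrow> bool" where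
  "AP_equivalence X R \<tau> \<longleftrightarrow>
     locally_compact_space X \<and> second_countable X \<and> Hausdorff_space X \<and>
     countable_equivalence X R \<and> (\<exists>Rs. defining_sequence X R \<tau> Rs)"

definition AF_equivalence ::
    "'a topology \<Rightarrow> ('a \<times> 'a) set \<Rightarrow> ('a \<times> 'a) topology \<Rightarrow> bool" where
  "AF_equivalence X R \<tau> \<longleftrightarrow> AP_equivalence X R \<tau> \<and> totally_disconnected_space X"

section \<open>Locally compact groups and cocycles\<close>

text \<open>Locally compact groups are Hausdorff, as usual.\<close>

definition locally_compact_group :: "('g, 'm) monoid_scheme \<Rightarrow> 'g topology \<Rightarrow> bool" where
  "locally_compact_group A T \<longleftrightarrow>
     group A \<and> topspace T = carrier A \<and>
     continuous_map (prod_topology T T) T (\<lambda>(a, b). a \<otimes>\<^bsub>A\<^esub> b) \<and>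
     continuous_map T T (\<lambda>a. inv\<^bsub>A\<^esub> a) \<and>
     locally_compact_space T \<and> Hausdorff_space T"

text \<open>Only the values on \<open>R\<close> of an element of \<open>cocycles R A\<close> matter.\<close>

definition cocycles :: "('a \<times> 'a) set \<Rightarrow> ('g, 'm) monoid_scheme \<Rightarrow> ('a \<times> 'a \<Rightarrow> 'g) set" where
  "cocycles R A = {c \<in> R \<rightarrow> carrier A.
     \<forall>x y z. (x, y) \<in> R \<longrightarrow> (y, z) \<in> R \<longrightarrow> c (x, y) \<otimes>\<^bsub>A\<^esub> c (y, z) = c (x, z)}"

definition continuously_cohomologous ::
    "'a topology \<Rightarrow> ('a \<times> 'a) set \<Rightarrow> ('g, 'm) monoid_scheme \<Rightarrow> 'g topology \<Rightarrow>
     ('a \<times> 'a \<Rightarrow> 'g) \<Rightarrow> ('a \<times> 'a \<Rightarrow> 'g) \<Rightarrow> bool" where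
  "continuously_cohomologous X R A T c c' \<longleftrightarrow>
     (\<exists>\<psi>. continuous_map X T \<psi> \<and>
        (\<forall>(x, y) \<in> R. c' (x, y) = \<psi> x \<otimes>\<^bsub>A\<^esub> c (x, y) \<otimes>\<^bsub>A\<^esub> inv\<^bsub>A\<^esub> (\<psi> y)))"

section \<open>Bratteli diagrams\<close>

locale bratteli_diagram = wf_digraph G
  for G :: "('v, 'e) pre_digraph" and lev :: "'v \<Rightarrow> nat" +
  assumes lev_head: "e \<in> arcs G \<Longrightarrow> lev (head G e) = Suc (lev (tail G e))"
    and finite_out: "v \<in> verts G \<Longrightarrow> finite (out_arcs G v)"
    and out_nonempty: "v \<in> verts G \<Longrightarrow> out_arcs G v \<noteq> {}"

text \<open>The edge \<open>x\<^sub>n\<close> (\<open>n \<ge> 1\<close>) of an infinite path \<open>x = x\<^sub>1 x\<^sub>2 \<dots>\<close> is \<open>x (n - 1)\<close> below.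
  Starting at level 0 forces \<open>x\<^sub>n \<in> E(n)\<close>.\<close>

definition infinite_paths :: "('v, 'e) pre_digraph \<Rightarrow> ('v \<Rightarrow> nat) \<Rightarrow> (nat \<Rightarrow> 'e) set" where
  "infinite_paths G lev =
     {x. lev (tail G (x 0)) = 0 \<and>
         (\<forall>n. x n \<in> arcs G \<and> head G (x n) = tail G (x (Suc n)))}"

text \<open>The cylinder of a list that is not a finite path from level 0 is empty.\<close>

definition cylinder :: "('v, 'e) pre_digraph \<Rightarrow> ('v \<Rightarrow> nat) \<Rightarrow> 'e list \<Rightarrow> (nat \<Rightarrow> 'e) set" where
  "cylinder G lev p = {x \<in> infinite_paths G lev. map x [0..<length p] = p}"

definition path_topology :: "('v, 'e) pre_digraph \<Rightarrow> ('v \<Rightarrow> nat) \<Rightarrow> (nat \<Rightarrow> 'e) topology" where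
  "path_topology G lev = topology_generated_by (range (cylinder G lev))"

definition tail_equivalence ::
    "('v, 'e) pre_digraph \<Rightarrow> ('v \<Rightarrow> nat) \<Rightarrow> ((nat \<Rightarrow> 'e) \<times> (nat \<Rightarrow> 'e)) set" where
  "tail_equivalence G lev =
     {(x, y). x \<in> infinite_paths G lev \<and> y \<in> infinite_paths G lev \<and>
        (\<exists>N. \<forall>n\<ge>N. x n = y n)}"

text \<open>The product
  \<open>f(x\<^sub>1) \<cdots> f(x\<^sub>n) f(y\<^sub>n)\<inverse> \<cdots> f(y\<^sub>1)\<inverse>\<close>.\<close>

definition quasi_product ::
    "('g, 'm) monoid_scheme \<Rightarrow> ('e \<Rightarrow> 'g) \<Rightarrow> (nat \<Rightarrow> 'e) \<Rightarrow> (nat \<Rightarrow> 'e) \<Rightarrow> nat \<Rightarrow> 'g" where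
  "quasi_product A f x y n =
     foldr (\<lambda>a b. a \<otimes>\<^bsub>A\<^esub> b)
       (map (\<lambda>i. f (x i)) [0..<n] @ map (\<lambda>i. inv\<^bsub>A\<^esub> (f (y i))) (rev [0..<n])) \<one>\<^bsub>A\<^esub>"

definition quasi_product_cocycle ::
    "('v, 'e) pre_digraph \<Rightarrow> ('v \<Rightarrow> nat) \<Rightarrow> ('g, 'm) monoid_scheme \<Rightarrow> 'g topology \<Rightarrow>
     ((nat \<Rightarrow> 'e) \<times> (nat \<Rightarrow> 'e) \<Rightarrow> 'g) \<Rightarrow> bool" where
  "quasi_product_cocycle G lev A T c \<longleftrightarrow>
     c \<in> cocycles (tail_equivalence G lev) A \<and>
     (\<exists>f \<in> arcs G \<rightarrow> carrier A. \<forall>(x, y) \<in> tail_equivalence G lev.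
        limitin T (quasi_product A f x y) (c (x, y)) sequentially)"

text \<open>A homeomorphism of \<open>X\<close> onto the path space of a Bratteli diagram carrying \<open>R\<close> onto the
  tail equivalence relation.\<close>

definition bratteli_model ::
    "'a topology \<Rightarrow> ('a \<times> 'a) set \<Rightarrow> ('v, 'e) pre_digraph \<Rightarrow> ('v \<Rightarrow> nat) \<Rightarrow>
     ('a \<Rightarrow> nat \<Rightarrow> 'e) \<Rightarrow> bool" where
  "bratteli_model X R G lev \<phi> \<longleftrightarrow>
     bratteli_diagram G lev \<and>
     homeomorphic_map X (path_topology G lev) \<phi> \<and>
     map_prod \<phi> \<phi> ` R = tail_equivalence G lev"

end

theory Submission
  imports Defs
begin

text \<open>
  The classes of a proper relation \<open>R\<close> on a compact totally disconnected space are finite, and those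
  that meet a small clopen set form a tower: finitely many disjoint clopen floors, each of which
  meets every class of the tower exactly once.  Here a decomposition of \<open>X\<close> into towers is given by a locally constant colouring that
  is adapted to \<open>R\<close>, the colours being the floors.  Adapted colourings that refine a given one exist
  (\<open>adapted_colouring\<close>), because the pattern that locally constant data make on the class of \<open>x\<close>
  varies locally constantly with \<open>x\<close> (\<open>locally_constant_class_pattern\<close>).  The data include the smaller
  relation of the preceding level and the values of a cocycle with finitely many values.

  For an increasing sequence of proper relations, starting with the identity, this gives a refining
  and separating sequence of tower decompositions.  The vertices of level \<open>n\<close> of the Bratteli diagram
  are the towers of level \<open>n\<close>; the edges from level \<open>n\<close> to level \<open>n + 1\<close> correspond to the copies of
  towers of level \<open>n\<close> into which the towers of level \<open>n + 1\<close> are cut.  The path of a point lists the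
  copies that it lies in.  Paths determine points because floors are determined by edges
  (\<open>path_prefix_eq_iff\<close>), all paths occur by compactness (\<open>path_surj\<close>), and paths with the same tail
  belong to related points because a class meets a floor at most once
  (\<open>tail_equivalent_imp_related\<close>).

  If the cocycle is constant on pairs of floors, then its values between points and a base floor of
  their towers form potentials of level \<open>n\<close>, whose increments from one level to the next depend on
  the edge only; labelling edges by these increments makes the quasi-product telescope to the cocycle
  (\<open>quasi_product_path\<close>).  The first claim of the theorem is the case of the trivial cocycle.

  For the last claim a general continuous cocycle is corrected level by level, with corrections that
  approach the unit so fast, along a countable base of compact neighbourhoods, that their products
  converge uniformly, and such that the correction at one level leaves the restriction of the
  cocycle to the preceding levels unchanged (\<open>finite_valued_cohomologous\<close>).
\<close>

section \<open>Locally constant maps\<close>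

definition locally_constant :: "'a topology \<Rightarrow> ('a \<Rightarrow> 'b) \<Rightarrow> bool" where
  "locally_constant X f \<longleftrightarrow>
     (\<forall>x\<in>topspace X. \<exists>U. openin X U \<and> x \<in> U \<and> (\<forall>y\<in>U. f y = f x))"

lemma locally_constantI:
  assumes "\<And>x. x \<in> topspace X \<Longrightarrow> \<exists>U. openin X U \<and> x \<in> U \<and> (\<forall>y\<in>U. f y = f x)"
  shows "locally_constant X f"
  using assms by (simp add: locally_constant_def)

lemma locally_constantE:
  assumes "locally_constant X f" "x \<in> topspace X"
  obtains U where "openin X U" "x \<in> U" "U \<subseteq> {y. f y = f x}"
  using assms that unfolding locally_constant_def by (metis (mono_tags, lifting) mem_Collect_eq subsetI)

lemma locally_constant_const: "locally_constant X (\<lambda>x. a)"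
  by (rule locally_constantI) blast

lemma locally_constant_Pair:
  assumes f: "locally_constant X f" and g: "locally_constant X g"
  shows "locally_constant X (\<lambda>x. (f x, g x))"
proof (rule locally_constantI)
  fix x assume x: "x \<in> topspace X"
  obtain U where "openin X U" "x \<in> U" "U \<subseteq> {y. f y = f x}"
    using locally_constantE[OF f x] by metis
  moreover obtain V where "openin X V" "x \<in> V" "V \<subseteq> {y. g y = g x}"
    using locally_constantE[OF g x] by metis
  ultimately show "\<exists>U. openin X U \<and> x \<in> U \<and> (\<forall>y\<in>U. (f y, g y) = (f x, g x))"
    by (intro exI[of _ "U \<inter> V"]) auto
qed

lemma locally_constant_determined:
  assumes f: "locally_constant X f"
    and det: "\<And>x y. x \<in> topspace X \<Longrightarrow> y \<in> topspace X \<Longrightarrow> f x = f y \<Longrightarrow> g x = g y"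
  shows "locally_constant X g"
proof (rule locally_constantI)
  fix x assume x: "x \<in> topspace X"
  obtain U where "openin X U" "x \<in> U" "U \<subseteq> {y. f y = f x}"
    using locally_constantE[OF f x] by metis
  with x show "\<exists>U. openin X U \<and> x \<in> U \<and> (\<forall>y\<in>U. g y = g x)"
    using det openin_subset by (metis (mono_tags, lifting) mem_Collect_eq subsetD)
qed

lemma locally_constant_compose:
  assumes f: "locally_constant Y f" and h: "continuous_map X Y h"
  shows "locally_constant X (\<lambda>x. f (h x))"
proof (rule locally_constantI)
  fix x assume x: "x \<in> topspace X"
  then have "h x \<in> topspace Y"
    using h by (auto simp: continuous_map_def)
  then obtain U where "openin Y U" "h x \<in> U" "U \<subseteq> {y. f y = f (h x)}"
    using locally_constantE[OF f] by metis
  with h x show "\<exists>U. openin X U \<and> x \<in> U \<and> (\<forall>y\<in>U. f (h y) = f (h x))"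
    by (intro exI[of _ "{z \<in> topspace X. h z \<in> U}"]) (auto simp: continuous_map_def)
qed

lemma openin_locally_constant:
  assumes "locally_constant X f"
  shows "openin X {x \<in> topspace X. P (f x)}"
  unfolding openin_subopen[of X "{x \<in> topspace X. P (f x)}"]
proof (intro ballI)
  fix x assume "x \<in> {x \<in> topspace X. P (f x)}"
  then have x: "x \<in> topspace X" "P (f x)"
    by auto
  then obtain U where "openin X U" "x \<in> U" "U \<subseteq> {y. f y = f x}"
    using locally_constantE[OF assms] by metis
  with x show "\<exists>T. openin X T \<and> x \<in> T \<and> T \<subseteq> {x \<in> topspace X. P (f x)}"
    by (intro exI[of _ U]) (auto dest: openin_subset)
qed

lemma closedin_locally_constant:
  assumes "locally_constant X f"
  shows "closedin X {x \<in> topspace X. P (f x)}"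
proof -
  have "topspace X - {x \<in> topspace X. P (f x)} = {x \<in> topspace X. \<not> P (f x)}"
    by auto
  then show ?thesis
    using openin_locally_constant[OF assms, of "\<lambda>a. \<not> P a"] by (simp add: closedin_def)
qed

lemma locally_constant_imp_continuous_map:
  assumes "locally_constant X f" "\<And>x. x \<in> topspace X \<Longrightarrow> f x \<in> topspace Y"
  shows "continuous_map X Y f"
  using assms openin_locally_constant by (auto simp: continuous_map_def)

lemma locally_constant_indicator:
  assumes "openin X U" "closedin X U"
  shows "locally_constant X (\<lambda>x. x \<in> U)"
proof (rule locally_constantI)
  fix x assume "x \<in> topspace X"
  then have "x \<in> (if x \<in> U then U else topspace X - U)"
    by auto
  moreover have "openin X (if x \<in> U then U else topspace X - U)"
    using assms by auto
  ultimately show "\<exists>V. openin X V \<and> x \<in> V \<and> (\<forall>y\<in>V. (y \<in> U) = (x \<in> U))"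
    by (metis DiffD2)
qed

lemma finite_image_locally_constant:
  assumes "compact_space X" "locally_constant X f"
  shows "finite (f ` topspace X)"
proof -
  let ?\<U> = "(\<lambda>x. {y \<in> topspace X. f y = f x}) ` topspace X"
  have "\<forall>U\<in>?\<U>. openin X U" "topspace X \<subseteq> \<Union>?\<U>"
    using openin_locally_constant[OF assms(2)] by auto
  then obtain F where F: "finite F" "F \<subseteq> ?\<U>" "topspace X \<subseteq> \<Union>F"
    using assms(1) unfolding compact_space_alt by meson
  then obtain S where S: "finite S" "S \<subseteq> topspace X" "F = (\<lambda>x. {y \<in> topspace X. f y = f x}) ` S"
    by (meson finite_subset_image)
  then have "f ` topspace X \<subseteq> f ` S"
    using F(3) by auto
  then show ?thesis
    using S(1) finite_surj by blast
qed

text \<open>Finitely many neighbourhoods may be intersected, so a map into the subsets of a finite set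
  inherits local constancy from its membership predicates.\<close>

lemma locally_constant_finite_sets:
  assumes "finite D" and sub: "\<And>x. x \<in> topspace X \<Longrightarrow> K x \<subseteq> D"
    and K: "\<And>d. d \<in> D \<Longrightarrow> locally_constant X (\<lambda>x. d \<in> K x)"
  shows "locally_constant X K"
proof (rule locally_constantI)
  fix x assume x: "x \<in> topspace X"
  have "\<forall>d\<in>D. \<exists>U. openin X U \<and> x \<in> U \<and> (\<forall>y\<in>U. (d \<in> K y) = (d \<in> K x))"
    using K x unfolding locally_constant_def by blast
  then obtain U where U: "\<And>d. d \<in> D \<Longrightarrow> openin X (U d) \<and> x \<in> U d \<and> (\<forall>y\<in>U d. (d \<in> K y) = (d \<in> K x))"
    by metis
  let ?W = "topspace X \<inter> \<Inter>(U ` D)"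
  have "openin X ?W"
    by (cases "D = {}") (auto simp: U \<open>finite D\<close> intro!: openin_Int openin_Inter)
  moreover have "K y = K x" if "y \<in> ?W" for y
  proof -
    have "d \<in> K y \<longleftrightarrow> d \<in> K x" if "d \<in> D" for d
      using U[OF that] \<open>y \<in> ?W\<close> that by blast
    moreover have "K y \<subseteq> D" "K x \<subseteq> D"
      using sub x \<open>y \<in> ?W\<close> by auto
    ultimately show ?thesis
      by blast
  qed
  ultimately show "\<exists>U. openin X U \<and> x \<in> U \<and> (\<forall>y\<in>U. K y = K x)"
    using x U by (intro exI[of _ ?W]) blast
qed

text \<open>By compactness the values are finitely many.  Numbers as values make it possible to code the
  vertices and edges of a diagram by numbers.\<close>

lemma locally_constant_nat_code:
  assumes "compact_space X" "locally_constant X f"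
  obtains p :: "'a \<Rightarrow> nat" where "locally_constant X p"
    "\<And>x y. x \<in> topspace X \<Longrightarrow> y \<in> topspace X \<Longrightarrow> p x = p y \<longleftrightarrow> f x = f y"
proof -
  let ?p = "\<lambda>x. to_nat_on (f ` topspace X) (f x)"
  have "countable (f ` topspace X)"
    by (simp add: assms countable_finite finite_image_locally_constant)
  then have "?p x = ?p y \<longleftrightarrow> f x = f y" if "x \<in> topspace X" "y \<in> topspace X" for x y
    using that by (simp add: to_nat_on_inj)
  moreover have "locally_constant X ?p"
    by (rule locally_constant_determined[OF assms(2)]) simp
  ultimately show ?thesis
    by (rule that[rotated])
qed

section \<open>Proper relations on Stone spaces\<close>

locale stone_space =
  fixes X :: "'a topology"
  assumes compact: "compact_space X" and Hausdorff: "Hausdorff_space X"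
    and totally_disconnected: "totally_disconnected_space X"
begin

text \<open>In a compact Hausdorff space the component of a point is the intersection of its clopen
  neighbourhoods; here components are points, so clopen sets form a basis.\<close>

lemma clopen_basis:
  assumes "openin X W" "x \<in> W"
  obtains U where "openin X U" "closedin X U" "x \<in> U" "U \<subseteq> W"
proof -
  have x: "x \<in> topspace X"
    using assms openin_subset by blast
  have mem: "x \<in> connected_component_of_set X x"
    using x by (simp add: connected_component_of_refl)
  obtain a where "connected_component_of_set X x \<subseteq> {a}"
    using totally_disconnected connectedin_connected_component_of[of X x]
    unfolding totally_disconnected_space_def by blast
  then have "connected_component_of_set X x = {x}"
    using mem by blast
  then have "{x} \<in> connected_components_of X"
    using x connected_component_in_connected_components_of[of X x] by simp
  moreover have "compactin X {x}"
    using x by simp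
  moreover have "locally_compact_space X"
    using compact by (rule compact_imp_locally_compact_space)
  ultimately obtain U V where "openin X U" "openin X V" "disjnt U V" "U \<union> V = topspace X"
      "{x} \<subseteq> U" "U \<subseteq> W"
    using wilder_locally_compact_component_thm[of X "{x}" W] assms Hausdorff by auto
  moreover have "closedin X U"
  proof -
    have "U = topspace X - V"
      using calculation by (auto simp: disjnt_def)
    then show ?thesis
      using calculation by auto
  qed
  ultimately show ?thesis
    using that by blast
qed

text \<open>Compactness turns a choice of a neighbourhood of each point into a locally constant choice of
  one neighbourhood, among finitely many, containing a given point.\<close>

lemma locally_constant_selection:
  assumes U: "\<And>z. z \<in> topspace X \<Longrightarrow> openin X (U z) \<and> z \<in> U z"
  obtains s where "locally_constant X s"
    "\<And>x. x \<in> topspace X \<Longrightarrow> s x \<in> topspace X \<and> x \<in> U (s x)"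
proof -
  have "\<exists>C. openin X C \<and> closedin X C \<and> z \<in> C \<and> C \<subseteq> U z" if "z \<in> topspace X" for z
    using U[OF that] clopen_basis by metis
  then obtain C where C: "\<And>z. z \<in> topspace X \<Longrightarrow>
      openin X (C z) \<and> closedin X (C z) \<and> z \<in> C z \<and> C z \<subseteq> U z"
    by metis
  have "\<forall>B\<in>C ` topspace X. openin X B" "topspace X \<subseteq> \<Union>(C ` topspace X)"
    using C by auto
  then obtain F where F: "finite F" "F \<subseteq> C ` topspace X" "topspace X \<subseteq> \<Union>F"
    using compact unfolding compact_space_alt by meson
  then obtain S where S: "finite S" "S \<subseteq> topspace X" "F = C ` S"
    by (meson finite_subset_image)
  define J where "J x = {z \<in> S. x \<in> C z}" for x
  have J: "locally_constant X J"
  proof (rule locally_constant_finite_sets[OF S(1)])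
    show "locally_constant X (\<lambda>x. z \<in> J x)" if "z \<in> S" for z
      using locally_constant_indicator[of X "C z"] C that S(2) by (auto simp: J_def)
  qed (auto simp: J_def)
  define s where "s x = (SOME z. z \<in> J x)" for x
  have "s x \<in> J x" if "x \<in> topspace X" for x
    unfolding s_def by (rule someI_ex) (use that F(3) S(3) in \<open>auto simp: J_def\<close>)
  then have "s x \<in> topspace X \<and> x \<in> U (s x)" if "x \<in> topspace X" for x
    using that S(2) C by (fastforce simp: J_def)
  moreover have "locally_constant X s"
    by (rule locally_constant_determined[OF J]) (simp add: s_def)
  ultimately show ?thesis
    by (rule that[rotated])
qed

text \<open>Every clopen set is a finite union of members of a countable basis, so there are only
  countably many of them.\<close>

lemma separating_clopen_sequence:
  assumes "second_countable X"
  obtains B :: "nat \<Rightarrow> 'a set" where "\<And>n. openin X (B n)" "\<And>n. closedin X (B n)"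
    "\<And>x y. x \<in> topspace X \<Longrightarrow> y \<in> topspace X \<Longrightarrow> x \<noteq> y \<Longrightarrow> \<exists>n. x \<in> B n \<and> y \<notin> B n"
proof -
  obtain \<B> where \<B>: "countable \<B>" "\<And>V. V \<in> \<B> \<Longrightarrow> openin X V"
    "\<And>U x. openin X U \<Longrightarrow> x \<in> U \<Longrightarrow> \<exists>V\<in>\<B>. x \<in> V \<and> V \<subseteq> U"
    using assms unfolding second_countable_def by metis
  let ?C = "{C. openin X C \<and> closedin X C}"
  have "C \<in> Union ` {F. finite F \<and> F \<subseteq> \<B>}" if C: "openin X C" "closedin X C" for C
  proof -
    have "compactin X C"
      using C(2) compact closedin_compact_space by blast
    moreover have "C \<subseteq> \<Union>{V \<in> \<B>. V \<subseteq> C}"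
      using \<B>(3)[OF C(1)] by blast
    moreover have "\<forall>V\<in>{V \<in> \<B>. V \<subseteq> C}. openin X V"
      using \<B>(2) by blast
    ultimately obtain F where "finite F" "F \<subseteq> {V \<in> \<B>. V \<subseteq> C}" "C \<subseteq> \<Union>F"
      unfolding compactin_def by meson
    then have "C = \<Union>F" "F \<in> {F. finite F \<and> F \<subseteq> \<B>}"
      by auto
    then show ?thesis
      by blast
  qed
  then have "?C \<subseteq> Union ` {F. finite F \<and> F \<subseteq> \<B>}"
    by blast
  then have cnt: "countable ?C"
    by (rule countable_subset) (intro countable_image countable_Collect_finite_subset \<B>(1))
  have ne: "?C \<noteq> {}"
    using openin_empty closedin_empty by blast
  let ?B = "from_nat_into ?C"
  have B: "openin X (?B n) \<and> closedin X (?B n)" for n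
    using from_nat_into[OF ne, of n] by simp
  have sep: "\<exists>n. x \<in> ?B n \<and> y \<notin> ?B n" if xy: "x \<in> topspace X" "y \<in> topspace X" "x \<noteq> y" for x y
  proof -
    have "closedin X {y}"
      using Hausdorff xy(2) by (simp add: closedin_Hausdorff_singleton)
    then have "openin X (topspace X - {y})"
      by blast
    then obtain U where "openin X U" "closedin X U" "x \<in> U" "U \<subseteq> topspace X - {y}"
      using clopen_basis[of "topspace X - {y}" x] xy by blast
    moreover from this obtain n where "?B n = U"
      using from_nat_into_surj[OF cnt, of U] by blast
    ultimately show ?thesis
      by blast
  qed
  show ?thesis
    using B sep by (intro that[of ?B]) blast+
qed

end

text \<open>That the quotient map is a local homeomorphism enters in two forms: saturations of open sets are
  open, and each point has a neighbourhood that meets no class twice.  That the graph is closed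
  gives closed saturations of closed sets, by compactness.\<close>

locale proper_relation = stone_space X for X :: "'a topology" +
  fixes R :: "('a \<times> 'a) set"
  assumes proper: "proper_equivalence X R"
begin

lemma equiv: "equiv (topspace X) R"
  using proper unfolding proper_equivalence_def countable_equivalence_def by blast

lemma refl: "x \<in> topspace X \<Longrightarrow> (x, x) \<in> R"
  using equiv by (meson equivE refl_onD)

lemma sym: "(x, y) \<in> R \<Longrightarrow> (y, x) \<in> R"
  using equiv by (meson equivE symD)

lemma trans: "(x, y) \<in> R \<Longrightarrow> (y, z) \<in> R \<Longrightarrow> (x, z) \<in> R"
  using equiv by (meson equivE transD)

lemma in_topspace: "(x, y) \<in> R \<Longrightarrow> x \<in> topspace X \<and> y \<in> topspace X"
  using equiv by (auto simp: equiv_def refl_on_def)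

lemma class_eq: "(x, y) \<in> R \<Longrightarrow> R `` {x} = R `` {y}"
  using equiv equiv_class_eq by metis

lemma closedin_graph: "closedin (prod_topology X X) R"
  using proper unfolding proper_equivalence_def by blast

abbreviation graph_topology :: "('a \<times> 'a) topology" where
  "graph_topology \<equiv> subtopology (prod_topology X X) R"

lemma graph_subset: "R \<subseteq> topspace (prod_topology X X)"
  using closedin_graph closedin_subset by blast

lemma topspace_graph: "topspace graph_topology = R"
  using graph_subset by (simp add: Int_absorb1)

lemma compact_graph: "compact_space graph_topology"
  using closedin_graph compact
  by (simp add: closedin_compact_space compact_space_prod_topology compact_space_subtopology)

lemma openin_saturation:
  assumes V: "openin X V"
  shows "openin X (R `` V)"
proof -
  let ?q = "\<lambda>x. R `` {x}"
  let ?Y = "quotient_topology X ?q"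
  have loc: "local_homeomorphism X ?Y ?q"
    using proper unfolding proper_equivalence_def by blast
  have "openin ?Y (?q ` V)"
    unfolding openin_subopen[of ?Y "?q ` V"]
  proof (intro ballI)
    fix c assume "c \<in> ?q ` V"
    then obtain x where x: "x \<in> V" "c = ?q x"
      by blast
    have "x \<in> topspace X"
      using x openin_subset[OF V] by blast
    then have "\<exists>U. openin X U \<and> x \<in> U \<and> openin ?Y (?q ` U) \<and>
        homeomorphic_map (subtopology X U) (subtopology ?Y (?q ` U)) ?q"
      using loc unfolding local_homeomorphism_def by (rule bspec[rotated])
    then obtain U where U: "openin X U" "x \<in> U" "openin ?Y (?q ` U)"
        "homeomorphic_map (subtopology X U) (subtopology ?Y (?q ` U)) ?q"
      by (elim exE conjE)
    have "openin (subtopology X U) (U \<inter> V)"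
      using V openin_subtopology_Int2 by blast
    then have "openin (subtopology ?Y (?q ` U)) (?q ` (U \<inter> V))"
      using U(4) homeomorphic_imp_open_map open_map_def by blast
    then have "openin ?Y (?q ` (U \<inter> V))"
      using U(3) openin_trans_full by blast
    then show "\<exists>T. openin ?Y T \<and> c \<in> T \<and> T \<subseteq> ?q ` V"
      using x U(2) by blast
  qed
  then have "openin X {x \<in> topspace X. ?q x \<in> ?q ` V}"
    by (simp add: openin_quotient_topology)
  also have "{x \<in> topspace X. ?q x \<in> ?q ` V} = R `` V"
  proof -
    have "x \<in> R `` V \<longleftrightarrow> x \<in> topspace X \<and> (\<exists>v\<in>V. ?q x = ?q v)" for x
    proof -
      have "V \<subseteq> topspace X"
        using V openin_subset by blast
      then show ?thesis
        using eq_equiv_class_iff[OF equiv] in_topspace sym by blast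
    qed
    then show ?thesis
      by auto
  qed
  finally show ?thesis .
qed

lemma locally_injective:
  assumes "x \<in> topspace X"
  obtains U where "openin X U" "x \<in> U" "\<And>y z. (y, z) \<in> R \<Longrightarrow> y \<in> U \<Longrightarrow> z \<in> U \<Longrightarrow> y = z"
proof -
  let ?q = "\<lambda>x. R `` {x}"
  have "local_homeomorphism X (quotient_topology X ?q) ?q"
    using proper unfolding proper_equivalence_def by blast
  then obtain U where U: "openin X U" "x \<in> U"
      "homeomorphic_map (subtopology X U) (subtopology (quotient_topology X ?q) (?q ` U)) ?q"
    using assms unfolding local_homeomorphism_def by blast
  have "inj_on ?q U"
    using homeomorphic_imp_injective_map[OF U(3)] openin_subset[OF U(1)]
    by (simp add: Int_absorb1)
  then show ?thesis
    using that[OF U(1,2)] class_eq by (meson inj_onD)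
qed

lemma closedin_saturation:
  assumes "closedin X F"
  shows "closedin X (R `` F)"
proof -
  have "closedin (prod_topology X X) (R \<inter> F \<times> topspace X)"
    using closedin_graph assms by (simp add: closedin_Int closedin_prod_Times_iff)
  then have "compactin (prod_topology X X) (R \<inter> F \<times> topspace X)"
    by (simp add: closedin_compact_space compact compact_space_prod_topology)
  then have "compactin X (snd ` (R \<inter> F \<times> topspace X))"
    using image_compactin continuous_map_snd by blast
  moreover have "snd ` (R \<inter> F \<times> topspace X) = R `` F"
    using in_topspace by force
  ultimately show ?thesis
    using Hausdorff compactin_imp_closedin by metis
qed

lemma continuous_map_graph:
  "continuous_map graph_topology X fst" "continuous_map graph_topology X snd"
  by (simp_all add: continuous_map_from_subtopology continuous_map_fst continuous_map_snd)

text \<open>The pattern that a locally constant labelling \<open>d\<close> of the graph of \<open>R\<close> makes on the class of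
  \<open>x\<close> varies locally constantly with \<open>x\<close>: the points whose class shows a given label form the
  saturation of the projection of a clopen subset of the graph.\<close>

lemma locally_constant_class_pattern:
  assumes d: "locally_constant graph_topology d"
  shows "locally_constant X (\<lambda>x. d ` (R `` {x} \<times> R `` {x}))"
proof (rule locally_constant_finite_sets)
  show "finite (d ` R)"
    using finite_image_locally_constant[OF compact_graph d] unfolding topspace_graph .
  show "d ` (R `` {x} \<times> R `` {x}) \<subseteq> d ` R" for x
  proof (intro image_mono subsetI)
    fix z assume "z \<in> R `` {x} \<times> R `` {x}"
    then show "z \<in> R"
      using sym[of x "fst z"] trans[of "fst z" x "snd z"] by auto
  qed
  fix a assume "a \<in> d ` R"
  define C where "C = {z \<in> R. d z = a}"
  have C: "openin graph_topology C" "closedin graph_topology C"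
    using openin_locally_constant[OF d, of "\<lambda>b. b = a"]
      closedin_locally_constant[OF d, of "\<lambda>b. b = a"] unfolding C_def topspace_graph by blast+
  have "compactin graph_topology C"
    using C(2) compact_graph closedin_compact_space by blast
  then have cl: "closedin X (fst ` C)"
    using image_compactin continuous_map_graph(1) Hausdorff compactin_imp_closedin by metis
  have "openin X (fst ` C)"
    unfolding openin_subopen[of X "fst ` C"]
  proof (intro ballI)
    fix y assume "y \<in> fst ` C"
    then obtain z where z: "(y, z) \<in> C"
      by auto
    obtain W where W: "openin (prod_topology X X) W" "C = W \<inter> R"
      using C(1) by (auto simp: openin_subtopology)
    then have yz: "(y, z) \<in> W"
      using z by blast
    obtain U V where UV: "openin X U" "openin X V" "y \<in> U" "z \<in> V" "U \<times> V \<subseteq> W"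
      using W(1)[unfolded openin_prod_topology_alt, rule_format, OF yz] by (elim exE conjE)
    have "openin X (U \<inter> R `` V)"
      using UV openin_saturation by blast
    moreover have "y \<in> U \<inter> R `` V"
      using UV z W sym by blast
    moreover have "U \<inter> R `` V \<subseteq> fst ` C"
    proof
      fix w assume "w \<in> U \<inter> R `` V"
      then obtain v where "w \<in> U" "v \<in> V" "(v, w) \<in> R"
        by blast
      then have "(w, v) \<in> C"
        using UV(5) W(2) sym[of v w] by blast
      then show "w \<in> fst ` C"
        by force
    qed
    ultimately show "\<exists>T. openin X T \<and> y \<in> T \<and> T \<subseteq> fst ` C"
      by blast
  qed
  then have "locally_constant X (\<lambda>x. x \<in> R `` (fst ` C))"
    using cl by (intro locally_constant_indicator openin_saturation closedin_saturation)
  moreover have "x \<in> R `` (fst ` C) \<longleftrightarrow> a \<in> d ` (R `` {x} \<times> R `` {x})" for x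
  proof
    assume "x \<in> R `` (fst ` C)"
    then obtain y z where "(y, x) \<in> R" "(y, z) \<in> R" "d (y, z) = a"
      by (auto simp: C_def)
    then have "(x, y) \<in> R" "(x, z) \<in> R" "d (y, z) = a"
      using sym[of y x] trans[of x y z] by auto
    then show "a \<in> d ` (R `` {x} \<times> R `` {x})"
      by blast
  next
    assume "a \<in> d ` (R `` {x} \<times> R `` {x})"
    then obtain y z where "(x, y) \<in> R" "(x, z) \<in> R" "d (y, z) = a"
      by auto
    then have "(y, x) \<in> R" "(y, z) \<in> C"
      using sym[of x y] trans[of y x z] by (simp_all add: C_def)
    then show "x \<in> R `` (fst ` C)"
      by force
  qed
  ultimately show "locally_constant X (\<lambda>x. a \<in> d ` (R `` {x} \<times> R `` {x}))"
    by simp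
qed

lemma locally_constant_class_image:
  assumes "locally_constant X u"
  shows "locally_constant X (\<lambda>x. u ` R `` {x})"
proof -
  have "locally_constant graph_topology (\<lambda>z. u (fst z))"
    using locally_constant_compose[OF assms continuous_map_graph(1)] .
  then have "locally_constant X (\<lambda>x. (\<lambda>z. u (fst z)) ` (R `` {x} \<times> R `` {x}))"
    by (rule locally_constant_class_pattern)
  moreover have "(\<lambda>z. u (fst z)) ` (R `` {x} \<times> R `` {x}) = u ` R `` {x}" for x
    by (auto simp: image_iff)
  ultimately show ?thesis
    by simp
qed

lemma locally_constant_injective_colouring:
  obtains u :: "'a \<Rightarrow> 'a" where "locally_constant X u" "\<And>x y. (x, y) \<in> R \<Longrightarrow> u x = u y \<Longrightarrow> x = y"
proof -
  have "\<exists>U. openin X U \<and> z \<in> U \<and> (\<forall>x y. (x, y) \<in> R \<longrightarrow> x \<in> U \<longrightarrow> y \<in> U \<longrightarrow> x = y)"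
    if "z \<in> topspace X" for z
    using locally_injective[OF that] by metis
  then obtain U where U: "\<And>z. z \<in> topspace X \<Longrightarrow>
      openin X (U z) \<and> z \<in> U z \<and> (\<forall>x y. (x, y) \<in> R \<longrightarrow> x \<in> U z \<longrightarrow> y \<in> U z \<longrightarrow> x = y)"
    by metis
  then have "\<And>z. z \<in> topspace X \<Longrightarrow> openin X (U z) \<and> z \<in> U z"
    by blast
  then obtain s where "locally_constant X s"
      "\<And>x. x \<in> topspace X \<Longrightarrow> s x \<in> topspace X \<and> x \<in> U (s x)"
    using locally_constant_selection by metis
  then show ?thesis
    using that[of s] U in_topspace by metis
qed

text \<open>The graph of \<open>S\<close> is closed because \<open>S\<close> is proper.  It is open in the graph of \<open>R\<close>: let \<open>V\<close> be
  a neighbourhood of \<open>y\<close> that meets no class of \<open>R\<close> twice; a pair of \<open>R\<close> with second component in \<open>V\<close>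
  and first component \<open>S\<close>-related to a point of \<open>V\<close> then belongs to \<open>S\<close>, since that point can only be
  the second component.\<close>

lemma locally_constant_subrelation:
  assumes S: "proper_relation X S" and "S \<subseteq> R"
  shows "locally_constant graph_topology (\<lambda>z. z \<in> S)"
proof (rule locally_constant_indicator)
  interpret S: proper_relation X S by fact
  show "closedin graph_topology S"
    using S.closedin_graph \<open>S \<subseteq> R\<close> closedin_subset_topspace by blast
  show "openin graph_topology S"
    unfolding openin_subopen[of _ S]
  proof (intro ballI)
    fix z assume "z \<in> S"
    then obtain x y where z: "z = (x, y)" "(x, y) \<in> S"
      by (cases z) auto
    obtain V where V: "openin X V" "y \<in> V" "\<And>a b. (a, b) \<in> R \<Longrightarrow> a \<in> V \<Longrightarrow> b \<in> V \<Longrightarrow> a = b"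
      using locally_injective S.in_topspace[OF z(2)] by metis
    let ?W = "R \<inter> (S `` V) \<times> V"
    have "openin (prod_topology X X) ((S `` V) \<times> V)"
      using V(1) S.openin_saturation by (simp add: openin_prod_Times_iff)
    then have "openin graph_topology ?W"
      using openin_subtopology_Int2 by blast
    moreover have "z \<in> ?W"
      using z V(2) S.sym[OF z(2)] \<open>S \<subseteq> R\<close> by auto
    moreover have "?W \<subseteq> S"
    proof
      fix w assume "w \<in> ?W"
      then obtain a b v where w: "w = (a, b)" "(a, b) \<in> R" "b \<in> V" "v \<in> V" "(v, a) \<in> S"
        by auto
      then have "(v, b) \<in> R"
        using \<open>S \<subseteq> R\<close> trans[of v a b] by blast
      then have "v = b"
        using V(3) w by metis
      then show "w \<in> S"
        using w S.sym[of v a] by simp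
    qed
    ultimately show "\<exists>T. openin graph_topology T \<and> z \<in> T \<and> T \<subseteq> S"
      by blast
  qed
qed

end

section \<open>Colourings adapted to proper relations\<close>

definition balanced :: "'a set \<Rightarrow> ('a \<times> 'a) set \<Rightarrow> ('a \<Rightarrow> 'b) \<Rightarrow> bool" where
  "balanced U R p \<longleftrightarrow>
     (\<forall>x y x'. x' \<in> U \<longrightarrow> (x, y) \<in> R \<longrightarrow> p x = p x' \<longrightarrow> (\<exists>y'. (x', y') \<in> R \<and> p y' = p y))"

lemma balancedD:
  assumes "balanced U R p" "x' \<in> U" "(x, y) \<in> R" "p x = p x'"
  obtains y' where "(x', y') \<in> R" "p y' = p y"
  using assms unfolding balanced_def by metis

lemma balanced_Id_on: "balanced U (Id_on U) p"
  by (auto simp: balanced_def)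

text \<open>The sets of constant colour are the floors of towers over the quotient by \<open>R\<close>, and \<open>c\<close> descends
  to pairs of floors of one tower.\<close>

definition adapted :: "'a set \<Rightarrow> ('a \<times> 'a) set \<Rightarrow> ('a \<times> 'a \<Rightarrow> 'c) \<Rightarrow> ('a \<Rightarrow> 'b) \<Rightarrow> bool" where
  "adapted U R c p \<longleftrightarrow>
     (\<forall>x y. (x, y) \<in> R \<longrightarrow> p x = p y \<longrightarrow> x = y) \<and> balanced U R p \<and>
     (\<forall>x y x' y'. (x, y) \<in> R \<longrightarrow> (x', y') \<in> R \<longrightarrow> p x = p x' \<longrightarrow> p y = p y' \<longrightarrow>
        c (x, y) = c (x', y'))"

lemma adapted_injective: "adapted U R c p \<Longrightarrow> (x, y) \<in> R \<Longrightarrow> p x = p y \<Longrightarrow> x = y"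
  and adapted_balanced: "adapted U R c p \<Longrightarrow> balanced U R p"
  and adapted_invariant: "adapted U R c p \<Longrightarrow> (x, y) \<in> R \<Longrightarrow> (x', y') \<in> R \<Longrightarrow>
    p x = p x' \<Longrightarrow> p y = p y' \<Longrightarrow> c (x, y) = c (x', y')"
  unfolding adapted_def by blast+

text \<open>The colour of \<open>x\<close> combines the colour given by a locally constant map that is injective on classes
  and the pattern of all relevant data on the class of \<open>x\<close>, which is the same for all points of the
  class.\<close>

lemma (in proper_relation) adapted_colouring:
  assumes S: "proper_relation X S" "S \<subseteq> R"
    and c: "locally_constant graph_topology c"
    and q: "locally_constant X q"
  shows "\<exists>p :: 'a \<Rightarrow> nat. locally_constant X p \<and> adapted (topspace X) R c p \<and>
    balanced (topspace X) S p \<and>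
    (\<forall>x\<in>topspace X. \<forall>y\<in>topspace X. p x = p y \<longrightarrow> q x = q y)"
proof -
  interpret S: proper_relation X S by fact
  obtain i :: "'a \<Rightarrow> 'a" where i: "locally_constant X i" "\<And>x y. (x, y) \<in> R \<Longrightarrow> i x = i y \<Longrightarrow> x = y"
    using locally_constant_injective_colouring by metis
  define u where "u x = (i x, q x)" for x
  have u: "locally_constant X u"
    unfolding u_def by (intro locally_constant_Pair i q)
  have u_inj: "x = y" if "(x, y) \<in> R" "u x = u y" for x y
    using that i(2) by (simp add: u_def)
  define d where "d z = ((u (fst z), u (snd z)), (z \<in> S, c z))" for z
  have d: "locally_constant graph_topology d"
    unfolding d_def
    by (intro locally_constant_Pair locally_constant_compose[OF u] continuous_map_graph c
        locally_constant_subrelation S)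
  define K where "K x = d ` (R `` {x} \<times> R `` {x})" for x
  have K: "locally_constant X K"
    unfolding K_def by (rule locally_constant_class_pattern[OF d])
  have K_eq: "K x = K y" if "(x, y) \<in> R" for x y
    by (simp add: K_def class_eq[OF that])
  \<comment> \<open>Equal patterns of two classes make the colour-preserving map between them an isomorphism of
    all the structure recorded by \<open>d\<close>.\<close>
  have transfer: "\<exists>y'. (x', y') \<in> R \<and> u y' = u y \<and> ((x', y') \<in> S \<longleftrightarrow> (x, y) \<in> S) \<and> c (x', y') = c (x, y)"
    if "(x, y) \<in> R" "x' \<in> topspace X" "u x = u x'" "K x = K x'" for x y x'
  proof -
    have "(x, x) \<in> R"
      using that(1) in_topspace refl by blast
    then have "d (x, y) \<in> K x"
      using that(1) by (auto simp: K_def)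
    then have "d (x, y) \<in> K x'"
      using that(4) by simp
    then obtain w y' where w: "(x', w) \<in> R" "(x', y') \<in> R" "d (w, y') = d (x, y)"
      unfolding K_def by auto
    then have "u w = u x'"
      using that(3) by (simp add: d_def)
    then have "w = x'"
      using u_inj[OF w(1)] by simp
    then show ?thesis
      using w by (auto simp: d_def)
  qed
  obtain p :: "'a \<Rightarrow> nat" where p: "locally_constant X p"
      "\<And>x y. x \<in> topspace X \<Longrightarrow> y \<in> topspace X \<Longrightarrow> p x = p y \<longleftrightarrow> (u x, K x) = (u y, K y)"
    using locally_constant_nat_code[OF compact locally_constant_Pair[OF u K]] by metis
  show ?thesis
  proof (intro exI[of _ p] conjI)
    show "locally_constant X p"
      by (fact p(1))
    show "\<forall>x\<in>topspace X. \<forall>y\<in>topspace X. p x = p y \<longrightarrow> q x = q y"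
      using p(2) by (simp add: u_def)
    show "balanced (topspace X) S p"
      unfolding balanced_def
    proof (intro allI impI)
      fix x y x' assume a: "x' \<in> topspace X" "(x, y) \<in> S" "p x = p x'"
      then have ux: "u x = u x'" "K x = K x'" and xy: "(x, y) \<in> R"
        using p(2) S.in_topspace S(2) by auto
      obtain y' where y': "(x', y') \<in> R" "u y' = u y" "(x', y') \<in> S"
        using transfer[OF xy a(1) ux] a(2) by blast
      then have "K y' = K y"
        using K_eq xy ux(2) by metis
      then show "\<exists>y'. (x', y') \<in> S \<and> p y' = p y"
        using y' p(2) in_topspace xy by (metis (no_types, lifting))
    qed
    have "x = y" if "(x, y) \<in> R" "p x = p y" for x y
      using that p(2) u_inj in_topspace[OF that(1)] by simp
    moreover have "balanced (topspace X) R p"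
      unfolding balanced_def
    proof (intro allI impI)
      fix x y x' assume a: "x' \<in> topspace X" "(x, y) \<in> R" "p x = p x'"
      then have ux: "u x = u x'" "K x = K x'"
        using p(2) in_topspace by auto
      obtain y' where y': "(x', y') \<in> R" "u y' = u y"
        using transfer[OF a(2,1) ux] by blast
      then have "K y' = K y"
        using K_eq a(2) ux(2) by metis
      then show "\<exists>y'. (x', y') \<in> R \<and> p y' = p y"
        using y' p(2) in_topspace a(2) by (metis (no_types, lifting))
    qed
    moreover have "c (x, y) = c (x', y')"
      if a: "(x, y) \<in> R" "(x', y') \<in> R" "p x = p x'" "p y = p y'" for x y x' y'
    proof -
      have t: "x \<in> topspace X" "x' \<in> topspace X" "y \<in> topspace X" "y' \<in> topspace X"
        using a in_topspace by auto
      then have ux: "u x = u x'" "K x = K x'" and uy: "u y = u y'"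
        using p(2) a by auto
      obtain z where z: "(x', z) \<in> R" "u z = u y" "c (x', z) = c (x, y)"
        using transfer[OF a(1) t(2) ux] by blast
      then have "z = y'"
        using u_inj[of z y'] a(2) sym[of x' z] trans[of z x' y'] uy by simp
      then show ?thesis
        using z by simp
    qed
    ultimately show "adapted (topspace X) R c p"
      unfolding adapted_def by (intro conjI allI impI)
  qed
qed

text \<open>The identity relation is put at level 0 because the constant colouring is adapted to it: all
  infinite paths start at one vertex, and cocycles are trivial there.\<close>

definition level_relation :: "'a topology \<Rightarrow> (nat \<Rightarrow> ('a \<times> 'a) set) \<Rightarrow> nat \<Rightarrow> ('a \<times> 'a) set" where
  "level_relation X Rs n = (case n of 0 \<Rightarrow> Id_on (topspace X) | Suc m \<Rightarrow> Rs m)"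

lemma level_relation_simps [simp]:
  "level_relation X Rs 0 = Id_on (topspace X)" "level_relation X Rs (Suc n) = Rs n"
  by (simp_all add: level_relation_def)

text \<open>The towers of level \<open>n\<close> have the sets of constant colour \<open>p n\<close> as floors.  Balance of \<open>p (Suc n)\<close>
  also with respect to \<open>R n\<close> is what allows each tower of level \<open>n + 1\<close> to be cut into copies of towers
  of level \<open>n\<close>.\<close>

locale tower_sequence = stone_space X for X :: "'a topology" +
  fixes R :: "nat \<Rightarrow> ('a \<times> 'a) set" and p :: "nat \<Rightarrow> 'a \<Rightarrow> nat"
  assumes equiv: "equiv (topspace X) (R n)"
    and R_0: "R 0 = Id_on (topspace X)"
    and R_Suc: "R n \<subseteq> R (Suc n)"
    and p_locally_constant: "locally_constant X (p n)"
    and p_0: "p 0 x = 0"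
    and p_refines: "x \<in> topspace X \<Longrightarrow> y \<in> topspace X \<Longrightarrow> p (Suc n) x = p (Suc n) y \<Longrightarrow> p n x = p n y"
    and p_injective: "(x, y) \<in> R n \<Longrightarrow> p n x = p n y \<Longrightarrow> x = y"
    and p_balanced: "balanced (topspace X) (R n) (p n)"
    and p_balanced_Suc: "balanced (topspace X) (R n) (p (Suc n))"
    and p_separates: "x \<in> topspace X \<Longrightarrow> y \<in> topspace X \<Longrightarrow> (\<And>n. p n x = p n y) \<Longrightarrow> x = y"

text \<open>The colourings are chosen recursively; the one of level \<open>n + 1\<close> refines the one of level \<open>n\<close> and
  the \<open>n\<close>-th member of a sequence of clopen sets that separates points.\<close>

lemma (in stone_space) tower_sequence_exists:
  assumes sc: "second_countable X" and Rs: "\<And>n. proper_equivalence X (Rs n)" and inc: "incseq Rs"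
    and c: "\<And>n. locally_constant (subtopology (prod_topology X X) (Rs n)) c"
    and c_diag: "\<And>x y. x \<in> topspace X \<Longrightarrow> y \<in> topspace X \<Longrightarrow> c (x, x) = c (y, y)"
  obtains p where "tower_sequence X (level_relation X Rs) p"
    "\<And>n. adapted (topspace X) (level_relation X Rs n) c (p n)"
proof -
  let ?R = "level_relation X Rs"
  obtain B :: "nat \<Rightarrow> 'a set" where B: "\<And>n. openin X (B n)" "\<And>n. closedin X (B n)"
      "\<And>x y. x \<in> topspace X \<Longrightarrow> y \<in> topspace X \<Longrightarrow> x \<noteq> y \<Longrightarrow> \<exists>n. x \<in> B n \<and> y \<notin> B n"
    using separating_clopen_sequence[OF sc] by metis
  have PR: "proper_relation X (Rs n)" for n
    using stone_space_axioms Rs by (simp add: proper_relation_def proper_relation_axioms_def)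
  define P where "P n (p :: 'a \<Rightarrow> nat) \<longleftrightarrow> locally_constant X p \<and> (n = 0 \<longrightarrow> p = (\<lambda>_. 0)) \<and>
      adapted (topspace X) (?R n) c p" for n p
  define Q where "Q n p (p' :: 'a \<Rightarrow> nat) \<longleftrightarrow> balanced (topspace X) (?R n) p' \<and>
      (\<forall>x\<in>topspace X. \<forall>y\<in>topspace X. p' x = p' y \<longrightarrow> p x = p y \<and> (x \<in> B n \<longleftrightarrow> y \<in> B n))"
    for n and p p' :: "'a \<Rightarrow> nat"
  have "\<exists>p. \<forall>n. P n (p n) \<and> Q n (p n) (p (Suc n))"
  proof (rule dependent_nat_choice)
    show "\<exists>p. P 0 p"
      using c_diag by (intro exI[of _ "\<lambda>_. 0"])
        (auto simp: P_def adapted_def locally_constant_const balanced_Id_on)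
  next
    fix p n assume "P n p"
    then have q: "locally_constant X (\<lambda>x. (p x, x \<in> B n))"
      using B by (auto simp: P_def intro!: locally_constant_Pair locally_constant_indicator)
    have S: "proper_relation X (Rs (n - 1))" "Rs (n - 1) \<subseteq> Rs n"
      using PR inc by (auto simp: incseq_def)
    obtain p' :: "'a \<Rightarrow> nat" where p': "locally_constant X p'" "adapted (topspace X) (Rs n) c p'"
        "balanced (topspace X) (Rs (n - 1)) p'"
        "\<forall>x\<in>topspace X. \<forall>y\<in>topspace X. p' x = p' y \<longrightarrow> (p x, x \<in> B n) = (p y, y \<in> B n)"
      using proper_relation.adapted_colouring[OF PR S c q] by (elim exE conjE)
    have bal: "balanced (topspace X) (?R n) p'"
      using p'(3) by (cases n) (simp_all add: balanced_Id_on)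
    have "P (Suc n) p'"
      unfolding P_def level_relation_simps using p'(1,2) by (intro conjI impI) auto
    moreover have "Q n p p'"
      unfolding Q_def using bal p'(4) unfolding prod.inject by (rule conjI)
    ultimately show "\<exists>p'. P (Suc n) p' \<and> Q n p p'"
      by (intro exI conjI)
  qed
  then obtain p where PQ: "\<And>n. P n (p n)" "\<And>n. Q n (p n) (p (Suc n))"
    by blast
  have "tower_sequence X ?R p"
  proof
    show "equiv (topspace X) (?R n)" for n
      using proper_relation.equiv[OF PR]
      by (cases n) (auto simp: intro!: equivI refl_onI sym_Id_on trans_Id_on)
    show "?R n \<subseteq> ?R (Suc n)" for n
    proof (cases n)
      case 0
      then show ?thesis
        using proper_relation.refl[OF PR] by auto
    next
      case (Suc m)
      then show ?thesis
        using incseq_SucD[OF inc] by simp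
    qed
    show "x = y" if xy: "x \<in> topspace X" "y \<in> topspace X" "\<And>n. p n x = p n y" for x y
    proof (rule ccontr)
      assume "x \<noteq> y"
      then obtain n where "x \<in> B n" "y \<notin> B n"
        using B(3)[OF xy(1,2)] by blast
      moreover have "p (Suc n) x = p (Suc n) y"
        by (fact xy(3))
      ultimately show False
        using PQ(2)[of n] xy(1,2) unfolding Q_def by blast
    qed
    show "p 0 x = 0" for x
      using PQ(1)[of 0] by (simp add: P_def)
    have ad: "adapted (topspace X) (?R n) c (p n)" for n
      using PQ(1)[of n] by (simp add: P_def)
    show "locally_constant X (p n)" for n
      using PQ(1)[of n] by (simp add: P_def)
    show "balanced (topspace X) (?R n) (p n)" for n
      using adapted_balanced[OF ad] .
    show "x = y" if "(x, y) \<in> ?R n" "p n x = p n y" for n x y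
      using adapted_injective[OF ad that] .
    show "balanced (topspace X) (?R n) (p (Suc n))" for n
      using PQ(2)[of n] unfolding Q_def by (rule conjunct1)
    show "p n x = p n y"
      if "x \<in> topspace X" "y \<in> topspace X" "p (Suc n) x = p (Suc n) y" for n x y
      using PQ(2)[of n] that unfolding Q_def by blast
  qed simp
  moreover have "adapted (topspace X) (?R n) c (p n)" for n
    using PQ(1)[of n] by (simp add: P_def)
  ultimately show ?thesis
    by (rule that)
qed

section \<open>The Bratteli diagram of a sequence of towers\<close>

text \<open>By balance two classes that share a colour have all their colours in common, so that sets of
  colours identify towers.\<close>

lemma colours_of_classes_eq_iff:
  assumes "equiv U R" "balanced U R q" "x \<in> U" "y \<in> U"
  shows "q ` R `` {x} = q ` R `` {y} \<longleftrightarrow> (\<exists>z. (y, z) \<in> R \<and> q z = q x)"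
proof
  assume eq: "q ` R `` {x} = q ` R `` {y}"
  have "x \<in> R `` {x}"
    using assms(1,3) by (rule equiv_class_self)
  then have "q x \<in> q ` R `` {y}"
    using eq by blast
  then show "\<exists>z. (y, z) \<in> R \<and> q z = q x"
    by auto
next
  assume "\<exists>z. (y, z) \<in> R \<and> q z = q x"
  then obtain z where z: "(y, z) \<in> R" "q z = q x"
    by blast
  then have "z \<in> U"
    using assms(1) by (auto simp: equiv_def refl_on_def)
  have *: "q ` R `` {a} \<subseteq> q ` R `` {b}" if b: "b \<in> U" "q a = q b" for a b
  proof
    fix t assume "t \<in> q ` R `` {a}"
    then obtain w where w: "(a, w) \<in> R" "t = q w"
      by blast
    obtain w' where "(b, w') \<in> R" "q w' = q w"
      using balancedD[OF assms(2) b(1) w(1) b(2)] .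
    then show "t \<in> q ` R `` {b}"
      using w(2) by (metis ImageI imageI insertI1)
  qed
  have "q ` R `` {x} = q ` R `` {z}"
    using *[OF \<open>z \<in> U\<close>, of x] *[OF \<open>x \<in> U\<close>, of z] z(2) by auto
  moreover have "R `` {y} = R `` {z}"
    using equiv_class_eq[OF assms(1) z(1)] .
  ultimately show "q ` R `` {x} = q ` R `` {y}"
    by simp
qed

context tower_sequence
begin

text \<open>A vertex of level \<open>n\<close> is a tower of \<open>R n\<close>, given by the colours of its floors.  An edge from
  level \<open>n\<close> to level \<open>n + 1\<close> is a set of floors of level \<open>n + 1\<close> that a class of \<open>R n\<close> runs through.\<close>

definition vertex :: "nat \<Rightarrow> 'a \<Rightarrow> nat" where
  "vertex n x = prod_encode (n, set_encode (p n ` R n `` {x}))"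

definition edge :: "nat \<Rightarrow> 'a \<Rightarrow> nat" where
  "edge n x = prod_encode (n, set_encode (p (Suc n) ` R n `` {x}))"

definition edge_representative :: "nat \<Rightarrow> nat \<times> 'a" where
  "edge_representative e = (SOME z. snd z \<in> topspace X \<and> edge (fst z) (snd z) = e)"

definition diagram :: "(nat, nat) pre_digraph" where
  "diagram = \<lparr>verts = {vertex n x | n x. x \<in> topspace X}, arcs = {edge n x | n x. x \<in> topspace X},
     tail = (\<lambda>e. vertex (fst (edge_representative e)) (snd (edge_representative e))),
     head = (\<lambda>e. vertex (Suc (fst (edge_representative e))) (snd (edge_representative e)))\<rparr>"

definition level :: "nat \<Rightarrow> nat" where
  "level v = fst (prod_decode v)"

definition path :: "'a \<Rightarrow> nat \<Rightarrow> nat" where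
  "path x n = edge n x"

lemma R_in_topspace: "(x, y) \<in> R n \<Longrightarrow> x \<in> topspace X \<and> y \<in> topspace X"
  using equiv[of n] by (auto simp: equiv_def refl_on_def)

lemma R_refl: "x \<in> topspace X \<Longrightarrow> (x, x) \<in> R n"
  using equiv[of n] by (meson equivE refl_onD)

lemma R_sym: "(x, y) \<in> R n \<Longrightarrow> (y, x) \<in> R n"
  using equiv[of n] by (meson equivE symD)

lemma R_trans: "(x, y) \<in> R n \<Longrightarrow> (y, z) \<in> R n \<Longrightarrow> (x, z) \<in> R n"
  using equiv[of n] by (meson equivE transD)

lemma R_mono: "m \<le> n \<Longrightarrow> R m \<subseteq> R n"
  using R_Suc by (rule lift_Suc_mono_le)

lemma p_refines_le:
  assumes "x \<in> topspace X" "y \<in> topspace X" "p n x = p n y" "m \<le> n"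
  shows "p m x = p m y"
  using assms(4,3)
proof (induction rule: inc_induct)
  case (step k)
  then show ?case
    using p_refines assms(1,2) by blast
qed simp

lemma finite_colours: "finite (p n ` R m `` {x})"
proof (rule finite_subset)
  show "p n ` R m `` {x} \<subseteq> p n ` topspace X"
    using R_in_topspace by blast
qed (rule finite_image_locally_constant[OF compact p_locally_constant])

lemma vertex_eq_iff:
  assumes "x \<in> topspace X" "y \<in> topspace X"
  shows "vertex m x = vertex n y \<longleftrightarrow> m = n \<and> (\<exists>z. (y, z) \<in> R n \<and> p n z = p n x)"
  using colours_of_classes_eq_iff[OF equiv p_balanced assms, of n]
  by (auto simp: vertex_def set_encode_eq finite_colours)

lemma edge_eq_iff:
  assumes "x \<in> topspace X" "y \<in> topspace X"
  shows "edge m x = edge n y \<longleftrightarrow> m = n \<and> (\<exists>z. (y, z) \<in> R n \<and> p (Suc n) z = p (Suc n) x)"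
  using colours_of_classes_eq_iff[OF equiv p_balanced_Suc assms, of n]
  by (auto simp: edge_def set_encode_eq finite_colours)

lemma level_vertex [simp]: "level (vertex n x) = n"
  by (simp add: level_def vertex_def)

lemma edge_representative:
  assumes "x \<in> topspace X"
  obtains y where "edge_representative (edge n x) = (n, y)" "y \<in> topspace X" "edge n y = edge n x"
proof -
  let ?z = "edge_representative (edge n x)"
  have z: "snd ?z \<in> topspace X" "edge (fst ?z) (snd ?z) = edge n x"
    using someI[of "\<lambda>z. snd z \<in> topspace X \<and> edge (fst z) (snd z) = edge n x" "(n, x)"] assms
    by (simp_all add: edge_representative_def)
  then have "fst ?z = n"
    using edge_eq_iff assms by blast
  with z show ?thesis
    using that[of "snd ?z"] by (metis prod.collapse)
qed

lemma tail_edge: "tail diagram (edge n x) = vertex n x"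
  and head_edge: "head diagram (edge n x) = vertex (Suc n) x" if x: "x \<in> topspace X"
proof -
  obtain y where y: "edge_representative (edge n x) = (n, y)" "y \<in> topspace X" "edge n y = edge n x"
    using edge_representative[OF x] .
  obtain z where z: "(x, z) \<in> R n" "p (Suc n) z = p (Suc n) y"
    using y edge_eq_iff[OF y(2) x] by blast
  have "p n z = p n y"
    using p_refines z R_in_topspace y(2) by blast
  then show "tail diagram (edge n x) = vertex n x"
    using y z vertex_eq_iff[OF y(2) x] by (auto simp: diagram_def)
  show "head diagram (edge n x) = vertex (Suc n) x"
    using y z vertex_eq_iff[OF y(2) x, of "Suc n" "Suc n"] R_Suc[of n]
    by (auto simp: diagram_def)
qed

lemma arcs_diagram: "arcs diagram = {edge n x | n x. x \<in> topspace X}"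
  and verts_diagram: "verts diagram = {vertex n x | n x. x \<in> topspace X}"
  by (simp_all add: diagram_def)

lemma bratteli_diagram: "bratteli_diagram diagram level"
proof
  fix e assume "e \<in> arcs diagram"
  then obtain n x where x: "e = edge n x" "x \<in> topspace X"
    by (auto simp: arcs_diagram)
  show "tail diagram e \<in> verts diagram" "head diagram e \<in> verts diagram"
    using x by (auto simp: tail_edge head_edge verts_diagram)
  show "level (head diagram e) = Suc (level (tail diagram e))"
    using x by (simp add: tail_edge head_edge)
next
  fix v assume "v \<in> verts diagram"
  then obtain n x where x: "v = vertex n x" "x \<in> topspace X"
    by (auto simp: verts_diagram)
  have "edge n x \<in> out_arcs diagram v"
    using x by (auto simp: out_arcs_def arcs_diagram tail_edge)
  then show "out_arcs diagram v \<noteq> {}"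
    by blast
  let ?C = "(\<lambda>C. prod_encode (n, set_encode C)) ` Pow (p (Suc n) ` topspace X)"
  have "out_arcs diagram v \<subseteq> ?C"
  proof
    fix e assume "e \<in> out_arcs diagram v"
    then obtain m y where y: "e = edge m y" "y \<in> topspace X" "tail diagram e = v"
      by (auto simp: out_arcs_def arcs_diagram)
    then have "level (vertex m y) = level (vertex n x)"
      using x by (simp add: tail_edge)
    moreover have "p (Suc n) ` R n `` {y} \<in> Pow (p (Suc n) ` topspace X)"
      using R_in_topspace by blast
    ultimately show "e \<in> ?C"
      using y(1) by (auto simp: edge_def)
  qed
  moreover have "finite ?C"
    using finite_image_locally_constant[OF compact p_locally_constant] by blast
  ultimately show "finite (out_arcs diagram v)"
    by (rule finite_subset)
qed

lemma path_in_infinite_paths: "x \<in> topspace X \<Longrightarrow> path x \<in> infinite_paths diagram level"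
  by (auto simp: infinite_paths_def path_def tail_edge head_edge arcs_diagram)

lemma infinite_path_edge:
  assumes w: "w \<in> infinite_paths diagram level"
  shows "\<exists>y\<in>topspace X. w n = edge n y"
proof -
  have arc: "w n \<in> arcs diagram" and step: "head diagram (w n) = tail diagram (w (Suc n))" for n
    using w by (auto simp: infinite_paths_def)
  have "level (tail diagram (w n)) = n"
  proof (induction n)
    case 0
    show ?case
      using w by (simp add: infinite_paths_def)
  next
    case (Suc n)
    then show ?case
      using bratteli_diagram.lev_head[OF bratteli_diagram arc] step by metis
  qed
  moreover obtain m y where "w n = edge m y" "y \<in> topspace X"
    using arc[of n] by (auto simp: arcs_diagram)
  ultimately show ?thesis
    using tail_edge level_vertex by auto
qed

text \<open>The floor of level \<open>n + 1\<close> that contains \<open>x\<close> is the only one on the edge of \<open>x\<close> that lies in the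
  floor of level \<open>n\<close> containing \<open>x\<close>.  So the edges, taken one by one, carry the same information as the
  floors.\<close>

lemma path_prefix_eq_iff:
  assumes x: "x \<in> topspace X" and y: "y \<in> topspace X"
  shows "(\<forall>i<n. path x i = path y i) \<longleftrightarrow> p n x = p n y"
proof
  assume "p n x = p n y"
  then have "p (Suc i) y = p (Suc i) x" if "i < n" for i
    using p_refines_le[OF x y, of n "Suc i"] that by simp
  then show "\<forall>i<n. path x i = path y i"
    unfolding path_def using R_refl[OF y] by (intro allI impI edge_eq_iff[OF x y, THEN iffD2]) auto
next
  show "\<forall>i<n. path x i = path y i \<Longrightarrow> p n x = p n y"
  proof (induction n)
    case 0
    show ?case
      by (simp add: p_0)
  next
    case (Suc n)
    then have IH: "p n x = p n y"
      using less_Suc_eq by blast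
    have "edge n x = edge n y"
      using Suc.prems by (simp add: path_def)
    then obtain z where z: "(y, z) \<in> R n" "p (Suc n) z = p (Suc n) x"
      using edge_eq_iff[OF x y] by blast
    then have "p n z = p n x"
      using p_refines[of z x n] R_in_topspace[OF z(1)] x z(2) by simp
    then have "y = z"
      using p_injective[OF z(1)] IH by metis
    then show ?case
      using z(2) by metis
  qed
qed

text \<open>The cylinder sets are not empty: the next edge leaves the tower that the point found so far lies
  in, so its floors meet every floor of that tower.\<close>

lemma infinite_path_prefix:
  assumes w: "w \<in> infinite_paths diagram level"
  shows "\<exists>x\<in>topspace X. \<forall>i<n. path x i = w i"
proof (induction n)
  case 0
  then show ?case
    using infinite_path_edge[OF w, of 0] by blast
next
  case (Suc n)
  obtain y where y: "y \<in> topspace X" "w n = edge n y"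
    using infinite_path_edge[OF w] by blast
  obtain x where x: "x \<in> topspace X" "\<forall>i<n. path x i = w i"
    using Suc.IH by blast
  have "vertex n x = vertex n y"
  proof (cases n)
    case 0
    then show ?thesis
      using vertex_eq_iff[OF x(1) y(1), of 0 0] R_refl[OF y(1)] by (auto simp: p_0)
  next
    case (Suc m)
    then have "vertex n x = head diagram (w m)"
      using x(2)[rule_format, of m] head_edge[OF x(1), of m] by (simp add: path_def)
    also have "\<dots> = tail diagram (w n)"
      using w Suc by (simp add: infinite_paths_def)
    also have "\<dots> = vertex n y"
      using y tail_edge by simp
    finally show ?thesis .
  qed
  then obtain z where z: "(y, z) \<in> R n" "p n z = p n x"
    using vertex_eq_iff[OF x(1) y(1)] by blast
  then have zX: "z \<in> topspace X"
    using R_in_topspace by blast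
  \<comment> \<open>\<open>z\<close> is on the same floor of level \<open>n\<close> as \<open>x\<close>, and on the same edge as \<open>y\<close>.\<close>
  have "\<forall>i<n. path z i = w i"
    using path_prefix_eq_iff[OF zX x(1), THEN iffD2, OF z(2)] x(2) by simp
  moreover have "path z n = w n"
    using edge_eq_iff[OF zX y(1)] z(1) y(2) by (auto simp: path_def)
  ultimately show ?case
    using zX by (auto simp: less_Suc_eq)
qed

lemma locally_constant_path: "locally_constant X (\<lambda>x. path x n)"
proof (rule locally_constant_determined[OF p_locally_constant])
  show "path x n = path y n"
    if "x \<in> topspace X" "y \<in> topspace X" "p (Suc n) x = p (Suc n) y" for x y
    using path_prefix_eq_iff[OF that(1,2), of "Suc n"] that(3) by simp
qed

lemma path_surj: "path ` topspace X = infinite_paths diagram level"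
proof
  show "path ` topspace X \<subseteq> infinite_paths diagram level"
    using path_in_infinite_paths by blast
  show "infinite_paths diagram level \<subseteq> path ` topspace X"
  proof
    fix w assume w: "w \<in> infinite_paths diagram level"
    define C where "C n = {x \<in> topspace X. \<forall>i<n. path x i = w i}" for n
    have closed: "closedin X (C n)" for n
    proof (induction n)
      case (Suc n)
      have "C (Suc n) = C n \<inter> {x \<in> topspace X. path x n = w n}"
        by (auto simp: C_def less_Suc_eq)
      then show ?case
        using Suc closedin_locally_constant[OF locally_constant_path, of "\<lambda>e. e = w n" n]
        by (simp add: closedin_Int)
    qed (simp add: C_def)
    have "C n \<noteq> {}" for n
      using infinite_path_prefix[OF w] by (auto simp: C_def)
    moreover have "decseq C"
      by (auto simp: decseq_def C_def)
    ultimately have "(\<Inter>n. C n) \<noteq> {}"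
      by (intro compact_space_imp_nest[OF compact closed])
    then obtain x where "\<And>n. x \<in> C n"
      by blast
    then have "x \<in> topspace X" "\<And>i. w i = path x i"
      unfolding C_def by (blast, metis (mono_tags, lifting) lessI mem_Collect_eq)
    then have "x \<in> topspace X" "w = path x"
      by blast+
    then show "w \<in> path ` topspace X"
      by blast
  qed
qed

lemma path_inj: "inj_on path (topspace X)"
proof (rule inj_onI)
  fix x y assume xy: "x \<in> topspace X" "y \<in> topspace X" "path x = path y"
  then have "p n x = p n y" for n
    using path_prefix_eq_iff[OF xy(1,2)] by simp
  then show "x = y"
    by (rule p_separates[OF xy(1,2)])
qed

end

lemma topspace_path_topology [simp]: "topspace (path_topology G lev) = infinite_paths G lev"
proof -
  have "cylinder G lev [] = infinite_paths G lev" "cylinder G lev c \<subseteq> infinite_paths G lev" for c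
    by (auto simp: cylinder_def)
  then have "\<Union> (range (cylinder G lev)) = infinite_paths G lev"
    by blast
  then show ?thesis
    unfolding path_topology_def topology_generated_by_topspace .
qed

lemma Hausdorff_path_topology:
  fixes G :: "('v, 'e) pre_digraph"
  shows "Hausdorff_space (path_topology G lev)"
  unfolding Hausdorff_space_def topspace_path_topology
proof (intro allI impI, elim conjE)
  fix w w' :: "nat \<Rightarrow> 'e"
  assume w: "w \<in> infinite_paths G lev" "w' \<in> infinite_paths G lev" "w \<noteq> w'"
  then obtain n where n: "w n \<noteq> w' n"
    by blast
  let ?Z = "\<lambda>u. cylinder G lev (map u [0..<Suc n])"
  have "openin (path_topology G lev) (?Z w)" "openin (path_topology G lev) (?Z w')"
    unfolding path_topology_def by (intro topology_generated_by_Basis rangeI)+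
  moreover have "w \<in> ?Z w" "w' \<in> ?Z w'"
    using w by (simp_all add: cylinder_def)
  moreover have "disjnt (?Z w) (?Z w')"
    using n by (auto simp: disjnt_def cylinder_def)
  ultimately show "\<exists>U V. openin (path_topology G lev) U \<and> openin (path_topology G lev) V \<and>
      w \<in> U \<and> w' \<in> V \<and> disjnt U V"
    by blast
qed

context tower_sequence
begin

lemma homeomorphic_map_path: "homeomorphic_map X (path_topology diagram level) path"
proof (rule continuous_imp_homeomorphic_map)
  show "continuous_map X (path_topology diagram level) path"
    unfolding path_topology_def
  proof (rule continuous_on_generated_topo)
    fix Z assume "Z \<in> range (cylinder diagram level)"
    then obtain es where Z: "Z = cylinder diagram level es"
      by blast
    have "map (path x) [0..<length es] = es \<longleftrightarrow> (\<forall>i<length es. path x i = es ! i)" for x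
      unfolding list_eq_iff_nth_eq by simp
    then have "path x \<in> Z \<longleftrightarrow> (\<forall>i<length es. path x i = es ! i)" if "x \<in> topspace X" for x
      unfolding Z cylinder_def mem_Collect_eq using path_in_infinite_paths[OF that] by blast
    then have "path -` Z \<inter> topspace X = {x \<in> topspace X. \<forall>i<length es. path x i = es ! i}"
      by blast
    moreover have "locally_constant X (\<lambda>x. \<forall>i<length es. path x i = es ! i)"
    proof (rule locally_constant_determined[OF p_locally_constant])
      show "(\<forall>i<length es. path x i = es ! i) = (\<forall>i<length es. path y i = es ! i)"
        if "x \<in> topspace X" "y \<in> topspace X" "p (length es) x = p (length es) y" for x y
        using path_prefix_eq_iff[OF that(1,2), THEN iffD2, OF that(3)] by (metis (no_types, lifting))
    qed
    then have "openin X {x \<in> topspace X. \<forall>i<length es. path x i = es ! i}"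
      by (rule openin_locally_constant[where P = "\<lambda>b. b"])
    ultimately show "openin X (path -` Z \<inter> topspace X)"
      by simp
  next
    show "path ` topspace X \<subseteq> \<Union> (range (cylinder diagram level))"
      using path_surj topspace_path_topology[of diagram level]
      by (simp add: path_topology_def)
  qed
qed (simp_all add: compact Hausdorff_path_topology path_surj path_inj)

text \<open>If the edges of \<open>x\<close> and \<open>y\<close> agree from level \<open>N\<close> on, then for \<open>m \<ge> N\<close> the class of \<open>x\<close> for \<open>R m\<close>
  contains a point of the floor of \<open>y\<close> of level \<open>m + 1\<close>.  These points do not depend on \<open>m\<close>, because
  a class meets each floor at most once; so they are all equal to \<open>y\<close>.\<close>

lemma tail_equivalent_imp_related:
  assumes x: "x \<in> topspace X" and y: "y \<in> topspace X"
    and tail: "\<And>n. n \<ge> N \<Longrightarrow> path x n = path y n"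
  shows "(x, y) \<in> R N"
proof -
  have "\<exists>z. (x, z) \<in> R n \<and> p (Suc n) z = p (Suc n) y" if "n \<ge> N" for n
    using tail[OF that] edge_eq_iff[OF y x, of n n] by (simp add: path_def)
  then obtain z where z: "\<And>n. n \<ge> N \<Longrightarrow> (x, z n) \<in> R n \<and> p (Suc n) (z n) = p (Suc n) y"
    by metis
  have zX: "z n \<in> topspace X" if "n \<ge> N" for n
    using z[OF that] R_in_topspace by blast
  have step: "z (Suc n) = z n" if "n \<ge> N" for n
  proof -
    have "p (Suc n) (z (Suc n)) = p (Suc n) y"
      using p_refines[OF zX[of "Suc n"] y, of "Suc n"] z[of "Suc n"] that by simp
    then have "p (Suc n) (z (Suc n)) = p (Suc n) (z n)"
      using z[OF that] by simp
    moreover have "(z (Suc n), z n) \<in> R (Suc n)"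
    proof (rule R_trans)
      show "(z (Suc n), x) \<in> R (Suc n)"
        using z[of "Suc n"] that by (simp add: R_sym)
      show "(x, z n) \<in> R (Suc n)"
        using z[OF that] subsetD[OF R_Suc] by (metis (no_types))
    qed
    ultimately show ?thesis
      by (rule p_injective[rotated])
  qed
  have const: "z n = z N" if "n \<ge> N" for n
    using that by (induction rule: dec_induct) (simp_all only: step)
  have far: "p (Suc n) (z N) = p (Suc n) y" if "n \<ge> N" for n
    using z[OF that] unfolding const[OF that] by (rule conjunct2)
  have "p n (z N) = p n y" for n
    by (rule p_refines_le[OF zX y far[of "max n N"]]) simp_all
  then have "z N = y"
    by (rule p_separates[OF zX[OF order_refl] y])
  then show ?thesis
    using z[of N] by simp
qed

lemma related_imp_path_eq:
  assumes "(x, y) \<in> R N" "N \<le> n"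
  shows "path x n = path y n"
proof -
  have "(y, x) \<in> R n"
    using assms R_mono R_sym by blast
  then show ?thesis
    using edge_eq_iff[of x y n n] R_in_topspace[OF assms(1)] by (auto simp: path_def)
qed

lemma path_tail_equivalence:
  "map_prod path path ` (\<Union>n. R n) = tail_equivalence diagram level"
proof
  show "map_prod path path ` (\<Union>n. R n) \<subseteq> tail_equivalence diagram level"
  proof
    fix z assume "z \<in> map_prod path path ` (\<Union>n. R n)"
    then obtain x y N where z: "z = (path x, path y)" and xy: "(x, y) \<in> R N"
      by auto
    have "path x \<in> infinite_paths diagram level" "path y \<in> infinite_paths diagram level"
      using R_in_topspace[OF xy] path_in_infinite_paths by auto
    then show "z \<in> tail_equivalence diagram level"
      using related_imp_path_eq[OF xy] by (auto simp: z tail_equivalence_def)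
  qed
  show "tail_equivalence diagram level \<subseteq> map_prod path path ` (\<Union>n. R n)"
  proof
    fix z assume "z \<in> tail_equivalence diagram level"
    then obtain w w' N where w: "z = (w, w')" "w \<in> path ` topspace X" "w' \<in> path ` topspace X"
        "\<forall>n\<ge>N. w n = w' n"
      unfolding tail_equivalence_def path_surj by auto
    then obtain x y where xy: "w = path x" "w' = path y" "x \<in> topspace X" "y \<in> topspace X"
      by auto
    then have "(x, y) \<in> R N"
      using w(4) by (intro tail_equivalent_imp_related) auto
    then show "z \<in> map_prod path path ` (\<Union>n. R n)"
      using w(1) xy(1,2) by (auto intro!: image_eqI[of _ _ "(x, y)"])
  qed
qed

theorem bratteli_model_path: "bratteli_model X (\<Union>n. R n) diagram level path"
  unfolding bratteli_model_def
  using bratteli_diagram homeomorphic_map_path path_tail_equivalence by blast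

end

section \<open>Quasi-product cocycles\<close>

lemma cocycle_closed: "c \<in> cocycles R A \<Longrightarrow> (x, y) \<in> R \<Longrightarrow> c (x, y) \<in> carrier A"
  by (auto simp: cocycles_def)

lemma cocycle_mult:
  "c \<in> cocycles R A \<Longrightarrow> (x, y) \<in> R \<Longrightarrow> (y, z) \<in> R \<Longrightarrow> c (x, y) \<otimes>\<^bsub>A\<^esub> c (y, z) = c (x, z)"
  unfolding cocycles_def by blast

lemma cocycle_diagonal:
  assumes "group A" "c \<in> cocycles R A" "(x, x) \<in> R"
  shows "c (x, x) = \<one>\<^bsub>A\<^esub>"
proof -
  interpret group A by fact
  have "c (x, x) \<otimes>\<^bsub>A\<^esub> c (x, x) = c (x, x)" "c (x, x) \<in> carrier A"
    using cocycle_mult[OF assms(2,3,3)] cocycle_closed[OF assms(2,3)] by auto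
  then show ?thesis
    using r_cancel_one by blast
qed

lemma quasi_product_telescope:
  assumes A: "group A"
    and g: "\<And>i. g i \<in> carrier A" "g 0 = \<one>\<^bsub>A\<^esub>"
    and h: "\<And>i. h i \<in> carrier A" "h 0 = \<one>\<^bsub>A\<^esub>"
    and f: "\<And>i. f (x i) = inv\<^bsub>A\<^esub> (g i) \<otimes>\<^bsub>A\<^esub> g (Suc i)" "\<And>i. f (y i) = inv\<^bsub>A\<^esub> (h i) \<otimes>\<^bsub>A\<^esub> h (Suc i)"
  shows "quasi_product A f x y n = g n \<otimes>\<^bsub>A\<^esub> inv\<^bsub>A\<^esub> (h n)"
proof -
  interpret group A by fact
  have left: "foldr (\<lambda>a b. a \<otimes>\<^bsub>A\<^esub> b) (map (\<lambda>i. f (x i)) [0..<n]) a = g n \<otimes>\<^bsub>A\<^esub> a"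
    if "a \<in> carrier A" for a n
    using that
  proof (induction n arbitrary: a)
    case 0
    then show ?case
      by (simp add: g)
  next
    case (Suc n)
    have "foldr (\<lambda>a b. a \<otimes>\<^bsub>A\<^esub> b) (map (\<lambda>i. f (x i)) [0..<Suc n]) a =
        g n \<otimes>\<^bsub>A\<^esub> ((inv\<^bsub>A\<^esub> (g n) \<otimes>\<^bsub>A\<^esub> g (Suc n)) \<otimes>\<^bsub>A\<^esub> a)"
      using Suc.IH[of "f (x n) \<otimes>\<^bsub>A\<^esub> a"] Suc.prems by (simp add: f g)
    also have "\<dots> = (g n \<otimes>\<^bsub>A\<^esub> inv\<^bsub>A\<^esub> (g n)) \<otimes>\<^bsub>A\<^esub> (g (Suc n) \<otimes>\<^bsub>A\<^esub> a)"
      using Suc.prems g(1)[of n] g(1)[of "Suc n"] by (simp only: m_assoc inv_closed m_closed)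
    also have "\<dots> = g (Suc n) \<otimes>\<^bsub>A\<^esub> a"
      using Suc.prems g(1)[of n] g(1)[of "Suc n"] by (simp only: r_inv l_one m_closed)
    finally show ?case .
  qed
  have right: "foldr (\<lambda>a b. a \<otimes>\<^bsub>A\<^esub> b) (map (\<lambda>i. inv\<^bsub>A\<^esub> (f (y i))) (rev [0..<n])) \<one>\<^bsub>A\<^esub> = inv\<^bsub>A\<^esub> (h n)" for n
  proof (induction n)
    case 0
    show ?case
      by (simp add: h)
  next
    case (Suc n)
    have "foldr (\<lambda>a b. a \<otimes>\<^bsub>A\<^esub> b) (map (\<lambda>i. inv\<^bsub>A\<^esub> (f (y i))) (rev [0..<Suc n])) \<one>\<^bsub>A\<^esub> =
        inv\<^bsub>A\<^esub> (inv\<^bsub>A\<^esub> (h n) \<otimes>\<^bsub>A\<^esub> h (Suc n)) \<otimes>\<^bsub>A\<^esub> inv\<^bsub>A\<^esub> (h n)"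
      using Suc.IH by (simp add: f)
    also have "\<dots> = inv\<^bsub>A\<^esub> (h n \<otimes>\<^bsub>A\<^esub> (inv\<^bsub>A\<^esub> (h n) \<otimes>\<^bsub>A\<^esub> h (Suc n)))"
      using h(1)[of n] h(1)[of "Suc n"] by (simp only: inv_mult_group m_closed inv_closed)
    also have "\<dots> = inv\<^bsub>A\<^esub> (h (Suc n))"
      using h(1)[of n] h(1)[of "Suc n"] by (simp only: m_assoc[symmetric] inv_closed r_inv l_one)
    finally show ?case .
  qed
  show ?thesis
    unfolding quasi_product_def foldr_append o_apply right by (rule left) (simp add: h)
qed

context tower_sequence
begin

text \<open>The floor with the least colour serves as the base of a tower.\<close>

definition base_point :: "nat \<Rightarrow> 'a \<Rightarrow> 'a" where
  "base_point n x = (SOME y. (x, y) \<in> R n \<and> p n y = Min (p n ` R n `` {x}))"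

lemma base_point:
  assumes "x \<in> topspace X"
  shows "(x, base_point n x) \<in> R n" "p n (base_point n x) = Min (p n ` R n `` {x})"
proof -
  have "p n ` R n `` {x} \<noteq> {}"
    using R_refl[OF assms] by blast
  then have "Min (p n ` R n `` {x}) \<in> p n ` R n `` {x}"
    by (rule Min_in[OF finite_colours])
  then have "\<exists>y. (x, y) \<in> R n \<and> p n y = Min (p n ` R n `` {x})"
    by auto
  from someI_ex[OF this]
  show "(x, base_point n x) \<in> R n" "p n (base_point n x) = Min (p n ` R n `` {x})"
    by (simp_all add: base_point_def)
qed

lemma base_point_cong:
  assumes "(x, y) \<in> R n"
  shows "base_point n x = base_point n y"
proof -
  have "R n `` {x} = R n `` {y}"
    using equiv_class_eq[OF equiv assms] .
  then have "(x, z) \<in> R n \<longleftrightarrow> (y, z) \<in> R n" for z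
    by blast
  then show ?thesis
    by (simp add: base_point_def \<open>R n `` {x} = R n `` {y}\<close>)
qed

end

locale tower_cocycle = tower_sequence X R p + group A
  for X :: "'a topology" and R p and A :: "('g, 'm) monoid_scheme" (structure) +
  fixes c :: "'a \<times> 'a \<Rightarrow> 'g"
  assumes cocycle: "c \<in> cocycles (\<Union>n. R n) A"
    and adapted: "adapted (topspace X) (R n) c (p n)"
begin

text \<open>On \<open>R n\<close> the cocycle is the coboundary of its values at the base points; these depend on the
  floor only, and their increments from level \<open>n\<close> to level \<open>n + 1\<close> depend on the edge only.\<close>

definition potential :: "nat \<Rightarrow> 'a \<Rightarrow> 'g" where
  "potential n x = c (x, base_point n x)"

definition increment :: "nat \<Rightarrow> 'a \<Rightarrow> 'g" where
  "increment n x = inv (potential n x) \<otimes> potential (Suc n) x"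

definition edge_label :: "nat \<Rightarrow> 'g" where
  "edge_label e = increment (fst (edge_representative e)) (snd (edge_representative e))"

lemma c_closed: "(x, y) \<in> R n \<Longrightarrow> c (x, y) \<in> carrier A"
  by (rule cocycle_closed[OF cocycle]) blast

lemma potential_closed: "x \<in> topspace X \<Longrightarrow> potential n x \<in> carrier A"
  unfolding potential_def using base_point(1) by (rule c_closed)

lemma increment_closed: "x \<in> topspace X \<Longrightarrow> increment n x \<in> carrier A"
  by (simp add: increment_def potential_closed)

lemma potential_cocycle:
  assumes "(x, y) \<in> R n"
  shows "potential n x = c (x, y) \<otimes> potential n y"
proof -
  have "(y, base_point n y) \<in> R n"
    using R_in_topspace[OF assms] base_point(1) by blast
  then have "c (x, y) \<otimes> c (y, base_point n y) = c (x, base_point n y)"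
    using assms by (intro cocycle_mult[OF cocycle]) auto
  then show ?thesis
    by (simp add: potential_def base_point_cong[OF assms])
qed

lemma cocycle_eq_coboundary:
  assumes "(x, y) \<in> R n"
  shows "c (x, y) = potential n x \<otimes> inv (potential n y)"
proof -
  have "potential n y \<in> carrier A"
    using R_in_topspace[OF assms] by (simp add: potential_closed)
  then show ?thesis
    using c_closed[OF assms] by (simp add: potential_cocycle[OF assms] m_assoc)
qed

lemma potential_floor:
  assumes x: "x \<in> topspace X" and y: "y \<in> topspace X" and xy: "p n x = p n y"
  shows "potential n x = potential n y"
proof -
  have "p n ` R n `` {x} = p n ` R n `` {y}"
    using colours_of_classes_eq_iff[OF equiv p_balanced x y, of n] R_refl[OF y, of n] xy by auto
  then have "p n (base_point n x) = p n (base_point n y)"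
    by (simp add: base_point x y)
  then show ?thesis
    unfolding potential_def
    by (rule adapted_invariant[OF adapted base_point(1)[OF x] base_point(1)[OF y] xy])
qed

lemma potential_0:
  assumes "x \<in> topspace X"
  shows "potential 0 x = \<one>"
proof -
  have "base_point 0 x = x"
    using base_point(1)[OF assms, of 0] by (simp add: R_0 Id_on_iff)
  moreover have "c (x, x) = \<one>"
    using R_refl[OF assms] by (intro cocycle_diagonal[OF is_group cocycle]) blast
  ultimately show ?thesis
    by (simp add: potential_def)
qed

lemma increment_class:
  assumes "(x, y) \<in> R n"
  shows "increment n x = increment n y"
proof -
  have xy: "(x, y) \<in> R (Suc n)"
    using assms R_Suc by blast
  have cl: "c (x, y) \<in> carrier A" "potential n y \<in> carrier A" "potential (Suc n) y \<in> carrier A"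
    using c_closed[OF assms] R_in_topspace[OF assms] by (simp_all add: potential_closed)
  have "increment n x = inv (c (x, y) \<otimes> potential n y) \<otimes> (c (x, y) \<otimes> potential (Suc n) y)"
    unfolding increment_def by (simp only: potential_cocycle[OF assms] potential_cocycle[OF xy])
  also have "\<dots> = inv (potential n y) \<otimes> (inv (c (x, y)) \<otimes> c (x, y)) \<otimes> potential (Suc n) y"
    using cl by (simp only: inv_mult_group m_assoc m_closed inv_closed)
  also have "\<dots> = increment n y"
    using cl by (simp only: l_inv r_one inv_closed increment_def)
  finally show ?thesis .
qed

lemma increment_edge:
  assumes x: "x \<in> topspace X" and y: "y \<in> topspace X" and xy: "edge n x = edge n y"
  shows "increment n x = increment n y"
proof -
  obtain z where z: "(y, z) \<in> R n" "p (Suc n) z = p (Suc n) x"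
    using edge_eq_iff[OF x y] xy by blast
  have zX: "z \<in> topspace X"
    using R_in_topspace[OF z(1)] by blast
  have "p n z = p n x"
    by (rule p_refines[OF zX x z(2)])
  then have "increment n z = increment n x"
    using potential_floor[OF zX x, of n] potential_floor[OF zX x z(2)] by (simp add: increment_def)
  then show ?thesis
    using increment_class[OF z(1)] by simp
qed

lemma edge_label_edge:
  assumes "x \<in> topspace X"
  shows "edge_label (edge n x) = increment n x"
proof -
  obtain y where y: "edge_representative (edge n x) = (n, y)" "y \<in> topspace X" "edge n y = edge n x"
    using edge_representative[OF assms] .
  show ?thesis
    using increment_edge[OF y(2) assms y(3)] by (simp add: edge_label_def y(1))
qed

lemma quasi_product_path:
  assumes "(x, y) \<in> R n"
  shows "quasi_product A edge_label (path x) (path y) n = c (x, y)"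
proof -
  have xy: "x \<in> topspace X" "y \<in> topspace X"
    using R_in_topspace[OF assms] by auto
  have "quasi_product A edge_label (path x) (path y) n = potential n x \<otimes> inv (potential n y)"
    by (rule quasi_product_telescope[OF is_group])
      (simp_all add: xy potential_closed potential_0 path_def edge_label_edge increment_def)
  then show ?thesis
    by (simp add: cocycle_eq_coboundary[OF assms])
qed

lemma quasi_product_cocycle_path:
  assumes T: "topspace T = carrier A"
  shows "quasi_product_cocycle diagram level A T (c \<circ> inv_into (\<Union>n. R n) (map_prod path path))"
proof -
  let ?d = "c \<circ> inv_into (\<Union>n. R n) (map_prod path path)"
  have inj: "inj_on (map_prod path path) (\<Union>n. R n)"
  proof (rule inj_on_subset[OF map_prod_inj_on[OF path_inj path_inj]])
    show "(\<Union>n. R n) \<subseteq> topspace X \<times> topspace X"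
      using R_in_topspace by auto
  qed
  have d: "?d (path x, path y) = c (x, y)" if "(x, y) \<in> R n" for x y n
  proof -
    have "inv_into (\<Union>n. R n) (map_prod path path) (map_prod path path (x, y)) = (x, y)"
      using that by (intro inv_into_f_f[OF inj]) blast
    then show ?thesis
      by simp
  qed
  have tail: "\<exists>x y n. w = path x \<and> w' = path y \<and> (x, y) \<in> R n"
    if "(w, w') \<in> tail_equivalence diagram level" for w w'
    using that unfolding path_tail_equivalence[symmetric] by auto
  have "?d \<in> cocycles (tail_equivalence diagram level) A"
    unfolding cocycles_def
  proof (intro CollectI conjI allI impI)
    show "?d \<in> tail_equivalence diagram level \<rightarrow> carrier A"
    proof
      fix z assume "z \<in> tail_equivalence diagram level"
      then obtain x y n where "z = (path x, path y)" "(x, y) \<in> R n"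
        using tail by (cases z) blast
      then show "?d z \<in> carrier A"
        using d c_closed by simp
    qed
  next
    fix u v w assume uv: "(u, v) \<in> tail_equivalence diagram level"
      and vw: "(v, w) \<in> tail_equivalence diagram level"
    obtain x y m where xy: "u = path x" "v = path y" "(x, y) \<in> R m"
      using tail[OF uv] by blast
    obtain y' z n where yz: "v = path y'" "w = path z" "(y', z) \<in> R n"
      using tail[OF vw] by blast
    have "y' = y"
      using path_inj xy(2) yz(1) R_in_topspace[OF xy(3)] R_in_topspace[OF yz(3)]
      by (auto dest: inj_onD)
    have N: "(x, y) \<in> R (max m n)" "(y, z) \<in> R (max m n)"
      using xy(3) yz(3) R_mono[of m "max m n"] R_mono[of n "max m n"] \<open>y' = y\<close> by auto
    have "c (x, y) \<otimes> c (y, z) = c (x, z)"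
      using N by (intro cocycle_mult[OF cocycle]) blast+
    then show "?d (u, v) \<otimes> ?d (v, w) = ?d (u, w)"
      unfolding xy(1,2) yz(2) d[OF N(1)] d[OF N(2)] d[OF R_trans[OF N]] .
  qed
  moreover have "edge_label \<in> arcs diagram \<rightarrow> carrier A"
    by (auto simp: arcs_diagram edge_label_edge increment_closed)
  moreover have "limitin T (quasi_product A edge_label w w') (?d (w, w')) sequentially"
    if ww': "(w, w') \<in> tail_equivalence diagram level" for w w'
  proof -
    obtain x y N where xy: "w = path x" "w' = path y" "(x, y) \<in> R N"
      using tail[OF ww'] by blast
    have "quasi_product A edge_label w w' n = c (x, y)" if "n \<ge> N" for n
      unfolding xy(1,2) using xy(3) R_mono[OF that] by (intro quasi_product_path) blast
    then have "\<forall>\<^sub>F n in sequentially. quasi_product A edge_label w w' n = ?d (w, w')"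
      unfolding eventually_sequentially xy(1,2) d[OF xy(3)] by blast
    then show ?thesis
      using c_closed[OF xy(3)] by (intro limitin_eventually) (simp_all add: T xy(1,2) d[OF xy(3), simplified])
  qed
  ultimately show ?thesis
    unfolding quasi_product_cocycle_def by blast
qed

end

section \<open>Locally compact groups\<close>

locale lc_group =
  fixes A :: "('g, 'm) monoid_scheme" (structure) and T :: "'g topology"
  assumes lc_group: "locally_compact_group A T"

sublocale lc_group \<subseteq> group A
  using lc_group by (simp add: locally_compact_group_def)

context lc_group
begin

lemma topspace_T: "topspace T = carrier A"
  and Hausdorff_T: "Hausdorff_space T"
  and locally_compact_T: "locally_compact_space T"
  using lc_group by (simp_all add: locally_compact_group_def)

lemma one_in_topspace: "\<one> \<in> topspace T"
  by (simp add: topspace_T)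

lemma continuous_map_carrier: "continuous_map Z T f \<Longrightarrow> x \<in> topspace Z \<Longrightarrow> f x \<in> carrier A"
  using topspace_T by (auto simp: continuous_map_def)

lemma inv_cancel: "a \<in> carrier A \<Longrightarrow> b \<in> carrier A \<Longrightarrow> inv a \<otimes> (a \<otimes> b) = b"
  "a \<in> carrier A \<Longrightarrow> b \<in> carrier A \<Longrightarrow> a \<otimes> (inv a \<otimes> b) = b"
  by (simp_all add: m_assoc[symmetric])

lemmas group_word_simps = m_assoc inv_mult_group inv_cancel

lemma continuous_map_mult:
  assumes "continuous_map Z T f" "continuous_map Z T g"
  shows "continuous_map Z T (\<lambda>x. f x \<otimes> g x)"
proof -
  have "continuous_map (prod_topology T T) T (\<lambda>(a, b). a \<otimes> b)"
    using lc_group by (simp add: locally_compact_group_def)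
  from continuous_map_compose[OF continuous_map_pairedI[OF assms] this]
  show ?thesis
    by (simp add: o_def)
qed

lemma continuous_map_inv:
  assumes "continuous_map Z T f"
  shows "continuous_map Z T (\<lambda>x. inv (f x))"
proof -
  have "continuous_map T T (\<lambda>a. inv a)"
    using lc_group by (simp add: locally_compact_group_def)
  from continuous_map_compose[OF assms this] show ?thesis
    by (simp add: o_def)
qed

lemma continuous_map_carrier_const: "a \<in> carrier A \<Longrightarrow> continuous_map Z T (\<lambda>x. a)"
  by (simp add: topspace_T)

lemma near_one:
  assumes f: "continuous_map (prod_topology T (prod_topology T T)) T f"
    and W: "openin T W" "f (\<one>, \<one>, \<one>) \<in> W"
  obtains N where "openin T N" "\<one> \<in> N"
    "\<And>a b d. a \<in> N \<Longrightarrow> b \<in> N \<Longrightarrow> d \<in> N \<Longrightarrow> f (a, b, d) \<in> W"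
proof -
  let ?P = "{z \<in> topspace (prod_topology T (prod_topology T T)). f z \<in> W}"
  have "openin (prod_topology T (prod_topology T T)) ?P"
    by (rule openin_continuous_map_preimage[OF f W(1)])
  moreover have "(\<one>, (\<one>, \<one>)) \<in> ?P"
    using W(2) one_in_topspace by simp
  ultimately have "\<exists>U Q. openin T U \<and> openin (prod_topology T T) Q \<and> \<one> \<in> U \<and>
      (\<one>, \<one>) \<in> Q \<and> U \<times> Q \<subseteq> ?P"
    by (simp only: openin_prod_topology_alt[of T "prod_topology T T"])
  then obtain U Q where UQ: "openin T U" "openin (prod_topology T T) Q" "\<one> \<in> U"
      "(\<one>, \<one>) \<in> Q" "U \<times> Q \<subseteq> ?P"
    by (elim exE conjE)
  have "\<exists>V V'. openin T V \<and> openin T V' \<and> \<one> \<in> V \<and> \<one> \<in> V' \<and> V \<times> V' \<subseteq> Q"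
    using UQ(2,4) by (simp only: openin_prod_topology_alt[of T T])
  then obtain V V' where V: "openin T V" "openin T V'" "\<one> \<in> V" "\<one> \<in> V'" "V \<times> V' \<subseteq> Q"
    by (elim exE conjE)
  show ?thesis
  proof (rule that)
    show "openin T (U \<inter> V \<inter> V')" "\<one> \<in> U \<inter> V \<inter> V'"
      using UQ V by auto
    show "f (a, b, d) \<in> W" if "a \<in> U \<inter> V \<inter> V'" "b \<in> U \<inter> V \<inter> V'" "d \<in> U \<inter> V \<inter> V'" for a b d
      using that UQ(5) V(5) by blast
  qed
qed

lemma compact_square_neighbourhood:
  assumes "openin T W" "\<one> \<in> W"
  obtains V U where "compactin T V" "openin T U" "\<one> \<in> U" "U \<subseteq> V" "V \<subseteq> W"
    "\<forall>a\<in>V. \<forall>b\<in>V. a \<otimes> b \<in> W"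
proof -
  have cont: "continuous_map (prod_topology T (prod_topology T T)) T (\<lambda>z. fst z \<otimes> fst (snd z))"
    by (intro continuous_map_mult continuous_map_fst continuous_map_compose[OF continuous_map_snd continuous_map_fst, unfolded o_def])
  obtain N where N: "openin T N" "\<one> \<in> N" "\<And>a b d. a \<in> N \<Longrightarrow> b \<in> N \<Longrightarrow> d \<in> N \<Longrightarrow> a \<otimes> b \<in> W"
    by (rule near_one[OF cont assms(1)]) (use assms(2) in simp_all)
  have "neighbourhood_base_of (compactin T) T"
    using locally_compact_T Hausdorff_T by (simp add: locally_compact_space_neighbourhood_base)
  moreover have "openin T (N \<inter> W)" "\<one> \<in> N \<inter> W"
    using N assms by auto
  ultimately have "\<exists>U V. openin T U \<and> compactin T V \<and> \<one> \<in> U \<and> U \<subseteq> V \<and> V \<subseteq> N \<inter> W"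
    by (simp only: neighbourhood_base_of)
  then obtain U V where UV: "openin T U" "compactin T V" "\<one> \<in> U" "U \<subseteq> V" "V \<subseteq> N \<inter> W"
    by (elim exE conjE)
  show ?thesis
    using UV(5) N(3)[OF _ _ N(2)] by (intro that[OF UV(2,1,3,4)]) blast+
qed

end

locale shrinking_neighbourhoods = lc_group A T for A :: "('g, 'm) monoid_scheme" (structure) and T +
  fixes V :: "nat \<Rightarrow> 'g set"
  assumes V_compact: "compactin T (V n)"
    and V_neighbourhood: "\<exists>U. openin T U \<and> \<one> \<in> U \<and> U \<subseteq> V n"
    and V_square: "a \<in> V (Suc n) \<Longrightarrow> b \<in> V (Suc n) \<Longrightarrow> a \<otimes> b \<in> V n"
    and V_base: "openin T W \<Longrightarrow> \<one> \<in> W \<Longrightarrow> \<exists>n. V (Suc n) \<subseteq> W"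
text \<open>The neighbourhoods are chosen recursively by \<open>compact_square_neighbourhood\<close>; since the \<open>(n + 1)\<close>-st
  one is also chosen inside the \<open>n\<close>-th member of a countable base at the unit, they form a base.\<close>

lemma (in lc_group) shrinking_neighbourhoods_exist:
  assumes "first_countable T"
  obtains V where "shrinking_neighbourhoods A T V"
proof -
  obtain \<B> where \<B>: "countable \<B>" "\<forall>V\<in>\<B>. openin T V"
      "\<forall>U. openin T U \<and> \<one> \<in> U \<longrightarrow> (\<exists>V\<in>\<B>. \<one> \<in> V \<and> V \<subseteq> U)"
    using assms one_in_topspace unfolding first_countable_def by meson
  have "\<B> \<noteq> {}"
    using \<B>(3)[rule_format, of "topspace T"] one_in_topspace by auto
  define B where "B n = (if \<one> \<in> from_nat_into \<B> n then from_nat_into \<B> n else topspace T)" for n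
  have B: "openin T (B n)" "\<one> \<in> B n" for n
    using \<B>(2) from_nat_into[OF \<open>\<B> \<noteq> {}\<close>] one_in_topspace by (simp_all add: B_def)
  define P where "P V \<longleftrightarrow> compactin T V \<and> (\<exists>U. openin T U \<and> \<one> \<in> U \<and> U \<subseteq> V)" for V
  define Q where "Q n V V' \<longleftrightarrow> V' \<subseteq> B n \<and> (\<forall>a\<in>V'. \<forall>b\<in>V'. a \<otimes> b \<in> V)" for n V V'
  have "\<exists>V. \<forall>n. P (V n) \<and> Q n (V n) (V (Suc n))"
  proof (rule dependent_nat_choice)
    obtain V U where "compactin T V" "openin T U" "\<one> \<in> U" "U \<subseteq> V"
      by (rule compact_square_neighbourhood[OF openin_topspace one_in_topspace])
    then show "\<exists>V. P V"
      unfolding P_def by blast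
  next
    fix V n assume "P V"
    then obtain U where U: "openin T U" "\<one> \<in> U" "U \<subseteq> V"
      unfolding P_def by blast
    have W: "openin T (U \<inter> B n)" "\<one> \<in> U \<inter> B n"
      using U B by auto
    obtain V' U' where V': "compactin T V'" "openin T U'" "\<one> \<in> U'" "U' \<subseteq> V'"
        "V' \<subseteq> U \<inter> B n" "\<forall>a\<in>V'. \<forall>b\<in>V'. a \<otimes> b \<in> U \<inter> B n"
      by (rule compact_square_neighbourhood[OF W])
    have "P V'"
      unfolding P_def using V'(1-4) by blast
    moreover have "Q n V V'"
      unfolding Q_def using V'(5,6) U(3) by blast
    ultimately show "\<exists>V'. P V' \<and> Q n V V'"
      by blast
  qed
  then obtain V where V: "\<And>n. P (V n)" "\<And>n. Q n (V n) (V (Suc n))"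
    by blast
  have "shrinking_neighbourhoods A T V"
  proof
    show "compactin T (V n)" "\<exists>U. openin T U \<and> \<one> \<in> U \<and> U \<subseteq> V n" for n
      using V(1)[of n] unfolding P_def by (rule conjunct1, rule conjunct2)
    show "a \<otimes> b \<in> V n" if "a \<in> V (Suc n)" "b \<in> V (Suc n)" for n a b
      using V(2)[of n] that unfolding Q_def by blast
    show "\<exists>n. V (Suc n) \<subseteq> W" if W: "openin T W" "\<one> \<in> W" for W
    proof -
      obtain D where D: "D \<in> \<B>" "\<one> \<in> D" "D \<subseteq> W"
        using \<B>(3) W by blast
      obtain n where "from_nat_into \<B> n = D"
        using from_nat_into_surj[OF \<B>(1) D(1)] by blast
      then have "B n = D"
        using D(2) by (simp add: B_def)
      then have "V (Suc n) \<subseteq> W"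
        using V(2)[of n] D(3) unfolding Q_def by blast
      then show ?thesis ..
    qed
  qed
  then show ?thesis
    by (rule that)
qed


context shrinking_neighbourhoods
begin

lemma one_in_V: "\<one> \<in> V n"
  using V_neighbourhood[of n] by blast

lemma V_subset_carrier: "V n \<subseteq> carrier A"
  using compactin_subset_topspace[OF V_compact] topspace_T by simp

lemma V_antimono: "m \<le> n \<Longrightarrow> V n \<subseteq> V m"
proof (rule lift_Suc_antimono_le)
  show "V (Suc n) \<subseteq> V n" for n
  proof
    fix a assume "a \<in> V (Suc n)"
    then show "a \<in> V n"
      using V_square[of a n \<one>] one_in_V V_subset_carrier[of "Suc n"] by auto
  qed
qed

text \<open>The sets of all \<open>v \<otimes> \<psi> n\<close> with \<open>v\<close> in \<open>V n\<close> are compact and decrease with \<open>n\<close>, because the square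
  of \<open>V (n + 1)\<close> is contained in \<open>V n\<close>; a point of their intersection is the limit.\<close>

lemma pointwise_limit:
  assumes \<psi>: "\<And>n. \<psi> n \<in> carrier A" and step: "\<And>n. \<psi> (Suc n) \<otimes> inv (\<psi> n) \<in> V (Suc n)"
  obtains a where "a \<in> carrier A" "\<And>n. a \<otimes> inv (\<psi> n) \<in> V n"
proof -
  define C where "C n = {a \<in> carrier A. a \<otimes> inv (\<psi> n) \<in> V n}" for n
  have comp: "compactin T (C n)" for n
  proof -
    have "continuous_map T T (\<lambda>v. v \<otimes> \<psi> n)"
      using \<psi> by (intro continuous_map_mult continuous_map_carrier_const) (simp_all add: continuous_map_id[unfolded id_def])
    then have "compactin T ((\<lambda>v. v \<otimes> \<psi> n) ` V n)"
      by (rule image_compactin[OF V_compact])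
    moreover have "(\<lambda>v. v \<otimes> \<psi> n) ` V n = C n"
    proof
      show "(\<lambda>v. v \<otimes> \<psi> n) ` V n \<subseteq> C n"
        using V_subset_carrier[of n] \<psi> by (auto simp: C_def m_assoc subset_iff)
      show "C n \<subseteq> (\<lambda>v. v \<otimes> \<psi> n) ` V n"
      proof
        fix a assume "a \<in> C n"
        then have "a \<otimes> inv (\<psi> n) \<in> V n" "a = (a \<otimes> inv (\<psi> n)) \<otimes> \<psi> n"
          using \<psi>[of n] by (auto simp: C_def m_assoc)
        then show "a \<in> (\<lambda>v. v \<otimes> \<psi> n) ` V n"
          by (rule rev_image_eqI)
      qed
    qed
    ultimately show ?thesis
      by simp
  qed
  have dec: "C (Suc n) \<subseteq> C n" for n
  proof
    fix a assume a: "a \<in> C (Suc n)"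
    then have "(a \<otimes> inv (\<psi> (Suc n))) \<otimes> (\<psi> (Suc n) \<otimes> inv (\<psi> n)) \<in> V n"
      using step[of n] by (intro V_square[of _ n]) (simp_all add: C_def)
    moreover have "(a \<otimes> inv (\<psi> (Suc n))) \<otimes> (\<psi> (Suc n) \<otimes> inv (\<psi> n)) = a \<otimes> inv (\<psi> n)"
      using a \<psi>[of n] \<psi>[of "Suc n"] by (simp add: C_def group_word_simps)
    ultimately show "a \<in> C n"
      using a by (simp add: C_def)
  qed
  have decseq: "decseq C"
    by (intro decseq_SucI dec)
  have "(\<Inter>n. C n) \<noteq> {}"
  proof (rule compact_space_imp_nest[of "subtopology T (C 0)"])
    show "compact_space (subtopology T (C 0))"
      by (rule compact_space_subtopology[OF comp])
    show "closedin (subtopology T (C 0)) (C n)" for n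
      using compactin_imp_closedin[OF Hausdorff_T comp] decseqD[OF decseq, of 0 n]
      by (intro closedin_subset_topspace) auto
    have "\<psi> n \<in> C n" for n
      using \<psi>[of n] one_in_V by (simp add: C_def)
    then show "C n \<noteq> {}" for n
      by blast
    show "decseq C"
      by (fact decseq)
  qed
  then obtain a where "\<And>n. a \<in> C n"
    by blast
  then show ?thesis
    using that[of a] by (auto simp: C_def)
qed

text \<open>The usual argument with three small errors: \<open>a y\<close> is the product of the errors at \<open>y\<close>, between \<open>y\<close>
  and \<open>x\<close>, and at \<open>x\<close>, and of \<open>a x\<close>.\<close>

lemma uniform_limit_continuous:
  assumes \<psi>: "\<And>n. continuous_map X T (\<psi> n)"
    and a: "\<And>x. x \<in> topspace X \<Longrightarrow> a x \<in> carrier A"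
    and close: "\<And>n x. x \<in> topspace X \<Longrightarrow> a x \<otimes> inv (\<psi> n x) \<in> V n"
  shows "continuous_map X T a"
proof -
  have nbhd: "\<exists>U. openin X U \<and> x \<in> U \<and> (\<forall>y\<in>U. a y \<in> W)"
    if x: "x \<in> topspace X" and W: "openin T W" "a x \<in> W" for x W
  proof -
    have pr: "continuous_map (prod_topology T (prod_topology T T)) T fst"
        "continuous_map (prod_topology T (prod_topology T T)) T (\<lambda>z. fst (snd z))"
        "continuous_map (prod_topology T (prod_topology T T)) T (\<lambda>z. snd (snd z))"
      using continuous_map_compose[OF continuous_map_snd continuous_map_fst]
        continuous_map_compose[OF continuous_map_snd continuous_map_snd]
      by (auto simp: o_def intro: continuous_map_fst)
    have "continuous_map (prod_topology T (prod_topology T T)) T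
        (\<lambda>z. fst z \<otimes> fst (snd z) \<otimes> inv (snd (snd z)) \<otimes> a x)"
      using a[OF x] by (intro continuous_map_mult continuous_map_inv continuous_map_carrier_const pr)
    then obtain N where N: "openin T N" "\<one> \<in> N"
        "\<And>s t u. s \<in> N \<Longrightarrow> t \<in> N \<Longrightarrow> u \<in> N \<Longrightarrow> s \<otimes> t \<otimes> inv u \<otimes> a x \<in> W"
      by (rule near_one[OF _ W(1)]) (use W(2) a[OF x] in simp_all)
    obtain n where n: "V (Suc n) \<subseteq> N"
      using V_base[OF N(1,2)] by blast
    let ?\<psi> = "\<psi> (Suc n)"
    let ?U = "{y \<in> topspace X. ?\<psi> y \<otimes> inv (?\<psi> x) \<in> N}"
    have \<psi>c: "?\<psi> y \<in> carrier A" if "y \<in> topspace X" for y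
      using continuous_map_carrier[OF \<psi> that] .
    have "continuous_map X T (\<lambda>y. ?\<psi> y \<otimes> inv (?\<psi> x))"
      using \<psi>c[OF x] by (intro continuous_map_mult continuous_map_carrier_const \<psi>) simp
    then have "openin X ?U"
      using N(1) by (rule openin_continuous_map_preimage)
    moreover have "x \<in> ?U"
      using x \<psi>c[OF x] N(2) by simp
    moreover have "a y \<in> W" if y: "y \<in> ?U" for y
    proof -
      have yX: "y \<in> topspace X"
        using y by blast
      have "(a y \<otimes> inv (?\<psi> y)) \<otimes> (?\<psi> y \<otimes> inv (?\<psi> x)) \<otimes> inv (a x \<otimes> inv (?\<psi> x)) \<otimes> a x \<in> W"
        using close[OF yX, of "Suc n"] close[OF x, of "Suc n"] n y by (intro N(3)) blast+
      moreover have "(a y \<otimes> inv (?\<psi> y)) \<otimes> (?\<psi> y \<otimes> inv (?\<psi> x)) \<otimes> inv (a x \<otimes> inv (?\<psi> x)) \<otimes> a x = a y"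
        using a[OF x] a[OF yX] \<psi>c[OF x] \<psi>c[OF yX] by (simp add: group_word_simps)
      ultimately show ?thesis
        by simp
    qed
    ultimately show ?thesis
      by blast
  qed
  then have "openin X {x \<in> topspace X. a x \<in> W}" if W: "openin T W" for W
    unfolding openin_subopen[of X "{x \<in> topspace X. a x \<in> W}"]
  proof (intro ballI)
    fix x assume "x \<in> {x \<in> topspace X. a x \<in> W}"
    then have "x \<in> topspace X" "a x \<in> W"
      by auto
    then obtain U where U: "openin X U" "x \<in> U" "\<forall>y\<in>U. a y \<in> W"
      using nbhd W by meson
    moreover have "U \<subseteq> topspace X"
      by (rule openin_subset[OF U(1)])
    ultimately show "\<exists>U. openin X U \<and> x \<in> U \<and> U \<subseteq> {x \<in> topspace X. a x \<in> W}"
      by (intro exI[of _ U]) auto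
  qed
  then show ?thesis
    using a by (simp add: continuous_map_def topspace_T)
qed

lemma conjugate_limit:
  assumes c: "c \<in> carrier A" "k \<in> carrier A" "a \<in> carrier A" "b \<in> carrier A"
    and \<psi>: "\<And>n. \<psi> n \<in> carrier A" "\<And>n. \<eta> n \<in> carrier A"
    and close: "\<And>n. a \<otimes> inv (\<psi> n) \<in> V n" "\<And>n. b \<otimes> inv (\<eta> n) \<in> V n"
    and k: "\<And>n. n \<ge> N \<Longrightarrow> \<psi> n \<otimes> c \<otimes> inv (\<eta> n) = k"
  shows "a \<otimes> c \<otimes> inv b = k"
proof (rule ccontr)
  let ?L = "a \<otimes> c \<otimes> inv b"
  assume neq: "?L \<noteq> k"
  have "closedin T {?L}"
    using c by (intro closedin_Hausdorff_singleton[OF Hausdorff_T]) (simp add: topspace_T)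
  then have W: "openin T (topspace T - {?L})"
    by blast
  have pr: "continuous_map (prod_topology T (prod_topology T T)) T (\<lambda>z. fst (snd z))"
    using continuous_map_compose[OF continuous_map_snd continuous_map_fst] by (simp add: o_def)
  have "continuous_map (prod_topology T (prod_topology T T)) T
      (\<lambda>z. fst z \<otimes> k \<otimes> inv (fst (snd z)))"
    using c by (intro continuous_map_mult continuous_map_inv continuous_map_carrier_const pr continuous_map_fst)
  then obtain U where U: "openin T U" "\<one> \<in> U"
      "\<And>s t u. s \<in> U \<Longrightarrow> t \<in> U \<Longrightarrow> u \<in> U \<Longrightarrow> s \<otimes> k \<otimes> inv t \<in> topspace T - {?L}"
    by (rule near_one[OF _ W]) (use neq c in \<open>simp_all add: topspace_T\<close>)
  obtain m where m: "V (Suc m) \<subseteq> U"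
    using V_base[OF U(1,2)] by blast
  let ?n = "max N (Suc m)"
  have "V ?n \<subseteq> U"
    using m V_antimono[of "Suc m" ?n] by auto
  then have "(a \<otimes> inv (\<psi> ?n)) \<otimes> k \<otimes> inv (b \<otimes> inv (\<eta> ?n)) \<in> topspace T - {?L}"
    using close[of ?n] by (intro U(3)[OF _ _ U(2)]) blast+
  moreover have "(a \<otimes> inv (\<psi> ?n)) \<otimes> k \<otimes> inv (b \<otimes> inv (\<eta> ?n)) = ?L"
    unfolding k[of ?n, OF max.cobounded1, symmetric]
    using c \<psi>(1)[of ?n] \<psi>(2)[of ?n] by (simp add: group_word_simps)
  ultimately show False
    by simp
qed

end

section \<open>Cocycles with finitely many values\<close>

context proper_relation
begin

text \<open>In each class the point with a prescribed colour is taken, for a locally constant colouring that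
  is injective on classes.\<close>

lemma continuous_transversal:
  obtains b where "continuous_map X X b" "\<And>x. x \<in> topspace X \<Longrightarrow> (x, b x) \<in> R"
    "\<And>x y. (x, y) \<in> R \<Longrightarrow> b x = b y"
proof -
  obtain u :: "'a \<Rightarrow> 'a" where u: "locally_constant X u"
      "\<And>x y. (x, y) \<in> R \<Longrightarrow> u x = u y \<Longrightarrow> x = y"
    using locally_constant_injective_colouring by metis
  define m where "m x = (SOME a. a \<in> u ` R `` {x})" for x
  have m: "locally_constant X m"
    by (rule locally_constant_determined[OF locally_constant_class_image[OF u(1)]])
      (simp only: m_def)
  have m_mem: "\<exists>y. (x, y) \<in> R \<and> u y = m x" if "x \<in> topspace X" for x
  proof -
    have "u x \<in> u ` R `` {x}"
      using refl[OF that] by blast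
    then have "m x \<in> u ` R `` {x}"
      unfolding m_def by (rule someI)
    then show ?thesis
      by auto
  qed
  define b where "b x = (SOME y. (x, y) \<in> R \<and> u y = m x)" for x
  have b: "(x, b x) \<in> R" "u (b x) = m x" if "x \<in> topspace X" for x
    using someI_ex[OF m_mem[OF that]] by (simp_all add: b_def)
  have b_cong: "b x = b y" if "(x, y) \<in> R" for x y
  proof (rule u(2))
    have xy: "x \<in> topspace X" "y \<in> topspace X"
      using in_topspace[OF that] by auto
    show "(b x, b y) \<in> R"
      using trans[OF sym[OF b(1)[OF xy(1)]] trans[OF that b(1)[OF xy(2)]]] .
    have "m x = m y"
      by (simp add: m_def class_eq[OF that])
    then show "u (b x) = u (b y)"
      by (simp add: b(2) xy)
  qed
  have "openin X {x \<in> topspace X. b x \<in> W}" if W: "openin X W" for W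
  proof -
    let ?S = "\<lambda>a. {x \<in> topspace X. m x = a} \<inter> R `` (W \<inter> {y \<in> topspace X. u y = a})"
    have "openin X (?S a)" for a
      using W openin_locally_constant[OF m, of "\<lambda>c. c = a"] openin_locally_constant[OF u(1), of "\<lambda>c. c = a"]
      by (intro openin_Int openin_saturation) auto
    then have "openin X (\<Union>a. ?S a)"
      by (intro openin_Union) auto
    moreover have "{x \<in> topspace X. b x \<in> W} = (\<Union>a. ?S a)"
    proof
      show "{x \<in> topspace X. b x \<in> W} \<subseteq> (\<Union>a. ?S a)"
      proof
        fix x assume "x \<in> {x \<in> topspace X. b x \<in> W}"
        then have x: "x \<in> topspace X" "b x \<in> W"
          by auto
        then have "b x \<in> W \<inter> {y \<in> topspace X. u y = m x}"
          using b[OF x(1)] in_topspace by blast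
        then have "x \<in> ?S (m x)"
          using x(1) sym[OF b(1)[OF x(1)]] by blast
        then show "x \<in> (\<Union>a. ?S a)"
          by blast
      qed
      show "(\<Union>a. ?S a) \<subseteq> {x \<in> topspace X. b x \<in> W}"
      proof
        fix x assume "x \<in> (\<Union>a. ?S a)"
        then obtain y where y: "x \<in> topspace X" "y \<in> W" "u y = m x" "(y, x) \<in> R"
          by blast
        have "y = b x"
          by (rule u(2)[OF trans[OF y(4) b(1)[OF y(1)]]]) (simp add: b(2)[OF y(1)] y(3))
        then show "x \<in> {x \<in> topspace X. b x \<in> W}"
          using y(1,2) by blast
      qed
    qed
    ultimately show ?thesis
      by simp
  qed
  then have "continuous_map X X b"
    using b(1) in_topspace by (auto simp: continuous_map_def)
  then show ?thesis
    using b(1) b_cong by (rule that)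
qed

end

locale proper_relation_group = proper_relation X R + lc_group A T
  for X :: "'a topology" and R and A :: "('g, 'm) monoid_scheme" (structure) and T :: "'g topology"
begin

text \<open>The value of the cocycle between a point and the chosen point of its class is a potential.\<close>

lemma continuous_cocycle_is_coboundary:
  assumes c: "c \<in> cocycles R A" and cont: "continuous_map graph_topology T c"
  obtains g where "continuous_map X T g" "\<And>x y. (x, y) \<in> R \<Longrightarrow> c (x, y) = g x \<otimes> inv (g y)"
proof -
  obtain b where b: "continuous_map X X b" "\<And>x. x \<in> topspace X \<Longrightarrow> (x, b x) \<in> R"
      "\<And>x y. (x, y) \<in> R \<Longrightarrow> b x = b y"
    using continuous_transversal by metis
  have "continuous_map X graph_topology (\<lambda>x. (x, b x))"
    using b(2) by (intro continuous_map_into_subtopology continuous_map_pairedI b(1) continuous_map_id[unfolded id_def]) auto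
  then have g: "continuous_map X T (\<lambda>x. c (x, b x))"
    using continuous_map_compose[OF _ cont] by (simp add: o_def)
  show ?thesis
  proof (rule that[OF g])
    fix x y assume xy: "(x, y) \<in> R"
    have yb: "(y, b y) \<in> R"
      using b(2) in_topspace[OF xy] by blast
    have "c (x, b x) = c (x, y) \<otimes> c (y, b y)"
      unfolding b(3)[OF xy] using cocycle_mult[OF c xy yb] by simp
    then show "c (x, y) = c (x, b x) \<otimes> inv (c (y, b y))"
      using cocycle_closed[OF c xy] cocycle_closed[OF c yb] by (simp add: m_assoc)
  qed
qed

text \<open>Near \<open>z\<close> the map \<open>k\<close> may be replaced by its value at \<open>z\<close>.  As \<open>h\<close> is not constant on classes, this
  has to be done for whole classes: the points whose class consists of good points form an open set,
  because saturations of closed sets are closed, and \<open>z\<close> is one of them, because \<open>k\<close> is constant on its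
  class.\<close>

lemma invariant_approximation:
  assumes k: "continuous_map X T k" "\<And>x y. (x, y) \<in> R \<Longrightarrow> k x = k y"
    and h: "continuous_map X T h"
    and W: "openin T W" "\<one> \<in> W"
  obtains l where "locally_constant X l" "\<forall>x\<in>topspace X. l x \<in> carrier A"
    "\<forall>(x, y)\<in>R. l x = l y"
    "\<forall>x\<in>topspace X. h x \<otimes> l x \<otimes> inv (k x) \<otimes> inv (h x) \<in> W"
proof -
  have kc: "k x \<in> carrier A" and hc: "h x \<in> carrier A" if "x \<in> topspace X" for x
    using continuous_map_carrier[OF k(1) that] continuous_map_carrier[OF h that] .
  define N where "N z = {x \<in> topspace X. h x \<otimes> k z \<otimes> inv (k x) \<otimes> inv (h x) \<in> W}" for z
  define M where "M z = topspace X - R `` (topspace X - N z)" for z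
  have M: "openin X (M z) \<and> z \<in> M z" if z: "z \<in> topspace X" for z
  proof
    have "continuous_map X T (\<lambda>x. h x \<otimes> k z \<otimes> inv (k x) \<otimes> inv (h x))"
      using kc[OF z] by (intro continuous_map_mult continuous_map_inv continuous_map_carrier_const k h)
    then have "openin X (N z)"
      unfolding N_def using W(1) by (rule openin_continuous_map_preimage)
    then have "closedin X (R `` (topspace X - N z))"
      by (intro closedin_saturation) blast
    then show "openin X (M z)"
      unfolding M_def by blast
    have "w \<in> N z" if wz: "(w, z) \<in> R" for w
    proof -
      have w: "w \<in> topspace X"
        using in_topspace[OF wz] by blast
      then have "h w \<otimes> k w \<otimes> inv (k w) \<otimes> inv (h w) = \<one>"
        using kc[OF w] hc[OF w] by (simp add: group_word_simps)
      then show ?thesis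
        using w W(2) k(2)[OF wz] by (simp add: N_def)
    qed
    then show "z \<in> M z"
      using z unfolding M_def by blast
  qed
  obtain s where s: "locally_constant X s"
      "\<And>x. x \<in> topspace X \<Longrightarrow> s x \<in> topspace X \<and> x \<in> M (s x)"
    using locally_constant_selection[of M] M by metis
  define t where "t x = (SOME z. z \<in> s ` R `` {x})" for x
  have t: "locally_constant X t"
    by (rule locally_constant_determined[OF locally_constant_class_image[OF s(1)]])
      (simp only: t_def)
  have t_eq: "t x = t y" if "(x, y) \<in> R" for x y
    by (simp add: t_def class_eq[OF that])
  have t_mem: "t x \<in> topspace X \<and> x \<in> N (t x)" if x: "x \<in> topspace X" for x
  proof -
    have "s x \<in> s ` R `` {x}"
      using refl[OF x] by blast
    then have "t x \<in> s ` R `` {x}"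
      unfolding t_def by (rule someI)
    then obtain y where y: "(x, y) \<in> R" "t x = s y"
      by auto
    have "y \<in> topspace X"
      using in_topspace[OF y(1)] by blast
    from s(2)[OF this] have "t x \<in> topspace X" "y \<in> M (t x)"
      unfolding y(2) by blast+
    moreover have "x \<in> N (t x)"
    proof (rule ccontr)
      assume "x \<notin> N (t x)"
      then have "y \<in> R `` (topspace X - N (t x))"
        using x y(1) by blast
      then show False
        using \<open>y \<in> M (t x)\<close> by (simp add: M_def)
    qed
    ultimately show ?thesis
      by blast
  qed
  show ?thesis
  proof (rule that[of "\<lambda>x. k (t x)"])
    show "locally_constant X (\<lambda>x. k (t x))"
      by (rule locally_constant_determined[OF t]) simp
    show "\<forall>x\<in>topspace X. k (t x) \<in> carrier A"
      using kc t_mem by blast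
    show "\<forall>(x, y)\<in>R. k (t x) = k (t y)"
      using t_eq by auto
    show "\<forall>x\<in>topspace X. h x \<otimes> k (t x) \<otimes> inv (k x) \<otimes> inv (h x) \<in> W"
      using t_mem unfolding N_def by blast
  qed
qed

end

lemma continuous_map_inductive_limit:
  assumes sub: "\<And>n. Rs n \<subseteq> topspace (prod_topology X X)"
  shows "continuous_map (inductive_limit_topology X Rs) T f \<longleftrightarrow>
    (\<forall>n. continuous_map (subtopology (prod_topology X X) (Rs n)) T f)"
proof -
  have top: "topspace (inductive_limit_topology X Rs) = (\<Union>n. Rs n)"
  proof
    show "topspace (inductive_limit_topology X Rs) \<subseteq> (\<Union>n. Rs n)"
      using openin_topspace[of "inductive_limit_topology X Rs"]
      unfolding openin_inductive_limit_topology by (rule conjunct1)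
    have "openin (subtopology (prod_topology X X) (Rs n)) ((\<Union>n. Rs n) \<inter> Rs n)" for n
    proof -
      have "(\<Union>n. Rs n) \<inter> Rs n = topspace (subtopology (prod_topology X X) (Rs n))"
        using sub[of n] by auto
      then show ?thesis
        by (simp only: openin_topspace)
    qed
    then have "openin (inductive_limit_topology X Rs) (\<Union>n. Rs n)"
      unfolding openin_inductive_limit_topology by blast
    then show "(\<Union>n. Rs n) \<subseteq> topspace (inductive_limit_topology X Rs)"
      by (rule openin_subset)
  qed
  have topn: "topspace (subtopology (prod_topology X X) (Rs n)) = Rs n" for n
    using sub[of n] by auto
  have Int: "{z \<in> \<Union>n. Rs n. f z \<in> U} \<inter> Rs n = {z \<in> Rs n. f z \<in> U}" for U n
    by auto
  show ?thesis
  proof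
    assume f: "continuous_map (inductive_limit_topology X Rs) T f"
    show "\<forall>n. continuous_map (subtopology (prod_topology X X) (Rs n)) T f"
    proof
      fix n
      show "continuous_map (subtopology (prod_topology X X) (Rs n)) T f"
        using f unfolding continuous_map_def top topn openin_inductive_limit_topology Int
        by (simp add: Pi_iff)
    qed
  next
    assume f: "\<forall>n. continuous_map (subtopology (prod_topology X X) (Rs n)) T f"
    then show "continuous_map (inductive_limit_topology X Rs) T f"
      unfolding continuous_map_def top topn openin_inductive_limit_topology Int
      by (auto simp: Pi_iff)
  qed
qed

lemma continuous_finite_imp_locally_constant:
  assumes f: "continuous_map Y T f" and T: "Hausdorff_space T" and fin: "finite (f ` topspace Y)"
  shows "locally_constant Y f"
proof (rule locally_constantI)
  fix x assume x: "x \<in> topspace Y"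
  have "closedin T (f ` topspace Y - {f x})"
    using fin f by (intro closedin_Hausdorff_finite[OF T]) (auto simp: continuous_map_def)
  then have "openin T (topspace T - (f ` topspace Y - {f x}))"
    by blast
  then have "openin Y {y \<in> topspace Y. f y \<in> topspace T - (f ` topspace Y - {f x})}"
    by (rule openin_continuous_map_preimage[OF f])
  moreover have "{y \<in> topspace Y. f y \<in> topspace T - (f ` topspace Y - {f x})} =
      {y \<in> topspace Y. f y = f x}"
    using f x by (auto simp: continuous_map_def)
  ultimately show "\<exists>U. openin Y U \<and> x \<in> U \<and> (\<forall>y\<in>U. f y = f x)"
    using x by (intro exI[of _ "{y \<in> topspace Y. f y = f x}"]) simp
qed

locale AF_sequence = stone_space X + lc_group A T
  for X :: "'a topology" and A :: "('g, 'm) monoid_scheme" (structure) and T :: "'g topology" +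
  fixes Rs :: "nat \<Rightarrow> ('a \<times> 'a) set"
  assumes Rs_proper: "proper_equivalence X (Rs n)" and Rs_incseq: "incseq Rs"
begin

lemma proper_relation_Rs: "proper_relation X (Rs n)"
  using stone_space_axioms Rs_proper by (simp add: proper_relation_def proper_relation_axioms_def)

lemma proper_relation_group_Rs: "proper_relation_group X (Rs n) A T"
  using proper_relation_Rs lc_group_axioms by (simp add: proper_relation_group_def)

lemmas Rs_in_topspace = proper_relation.in_topspace[OF proper_relation_Rs]

lemma Rs_mono: "m \<le> n \<Longrightarrow> Rs m \<subseteq> Rs n"
  using Rs_incseq by (rule incseqD)

lemma cocycle_restrict: "c \<in> cocycles (\<Union>n. Rs n) A \<Longrightarrow> c \<in> cocycles (Rs n) A"
  unfolding cocycles_def by blast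

text \<open>On each \<open>Rs n\<close> the cocycle is the coboundary of a continuous \<open>g n\<close>, and the quotient of \<open>g n\<close> and
  \<open>g (n + 1)\<close> is constant on the classes of \<open>Rs n\<close>.  Approximating these quotients by locally constant
  maps \<open>l\<close> with the same property and multiplying gives locally constant \<open>h n\<close> with two properties.  The
  coboundaries of \<open>h n\<close> and \<open>h (n + 1)\<close> agree on \<open>Rs n\<close>; and the continuous maps
  \<open>\<psi> n = h n \<otimes> inv (g n)\<close>, which carry the cocycle on \<open>Rs n\<close> to the coboundary of \<open>h n\<close>, converge
  uniformly.  Their limit carries the cocycle to the coboundary of \<open>h n\<close> on each \<open>Rs n\<close>, which takes
  finitely many values.\<close>

lemma finite_valued_cohomologous:
  assumes fc: "first_countable T" and c: "c \<in> cocycles (\<Union>n. Rs n) A"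
    and cont: "\<And>n. continuous_map (subtopology (prod_topology X X) (Rs n)) T c"
  obtains \<psi> where "continuous_map X T \<psi>"
    "\<And>n. finite ((\<lambda>(x, y). \<psi> x \<otimes> c (x, y) \<otimes> inv (\<psi> y)) ` Rs n)"
proof -
  obtain V where "shrinking_neighbourhoods A T V"
    by (rule shrinking_neighbourhoods_exist[OF fc])
  then interpret shrinking_neighbourhoods A T V .
  have "\<exists>g. continuous_map X T g \<and> (\<forall>x y. (x, y) \<in> Rs n \<longrightarrow> c (x, y) = g x \<otimes> inv (g y))" for n
    using proper_relation_group.continuous_cocycle_is_coboundary[OF proper_relation_group_Rs cocycle_restrict[OF c] cont]
    by metis
  then obtain g where g: "\<And>n. continuous_map X T (g n)"
      "\<And>n x y. (x, y) \<in> Rs n \<Longrightarrow> c (x, y) = g n x \<otimes> inv (g n y)"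
    by metis
  have gc: "g n x \<in> carrier A" if "x \<in> topspace X" for n x
    using continuous_map_carrier[OF g(1) that] .
  define P where "P h \<longleftrightarrow> locally_constant X h \<and> (\<forall>x\<in>topspace X. h x \<in> carrier A)" for h :: "'a \<Rightarrow> 'g"
  define Q where "Q n h h' \<longleftrightarrow>
      (\<forall>x y. (x, y) \<in> Rs n \<longrightarrow> h' x \<otimes> inv (h' y) = h x \<otimes> inv (h y)) \<and>
      (\<forall>x\<in>topspace X. (h' x \<otimes> inv (g (Suc n) x)) \<otimes> inv (h x \<otimes> inv (g n x)) \<in> V (Suc n))"
    for n and h h' :: "'a \<Rightarrow> 'g"
  have "\<exists>h. \<forall>n. P (h n) \<and> Q n (h n) (h (Suc n))"
  proof (rule dependent_nat_choice)
    show "\<exists>h. P h"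
      by (intro exI[of _ "\<lambda>_. \<one>"]) (simp add: P_def locally_constant_const)
  next
    fix h n assume h: "P h"
    then have hc: "h x \<in> carrier A" if "x \<in> topspace X" for x
      using that by (simp add: P_def)
    have hcont: "continuous_map X T h"
      using h hc by (intro locally_constant_imp_continuous_map) (simp_all add: P_def topspace_T)
    define k where "k x = inv (g n x) \<otimes> g (Suc n) x" for x
    have kcont: "continuous_map X T k"
      unfolding k_def by (intro continuous_map_mult continuous_map_inv g)
    \<comment> \<open>Two potentials for the same cocycle on \<open>Rs n\<close> differ by a map that is constant on classes.\<close>
    have kinv: "k x = k y" if xy: "(x, y) \<in> Rs n" for x y
    proof -
      have xX: "x \<in> topspace X" "y \<in> topspace X"
        using Rs_in_topspace[OF xy] by auto
      have "(x, y) \<in> Rs (Suc n)"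
        using xy Rs_mono[of n "Suc n"] by auto
      then have "g n x \<otimes> inv (g n y) = g (Suc n) x \<otimes> inv (g (Suc n) y)"
        using g(2)[OF xy] g(2)[of x y "Suc n"] by simp
      then have "inv (g n x) \<otimes> (g n x \<otimes> inv (g n y)) \<otimes> g (Suc n) y =
          inv (g n x) \<otimes> (g (Suc n) x \<otimes> inv (g (Suc n) y)) \<otimes> g (Suc n) y"
        by simp
      then show ?thesis
        using gc[OF xX(1)] gc[OF xX(2)] by (simp add: k_def group_word_simps)
    qed
    obtain W where W: "openin T W" "\<one> \<in> W" "W \<subseteq> V (Suc n)"
      using V_neighbourhood[of "Suc n"] by blast
    obtain l where l: "locally_constant X l" "\<forall>x\<in>topspace X. l x \<in> carrier A"
        "\<forall>(x, y)\<in>Rs n. l x = l y"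
        "\<forall>x\<in>topspace X. h x \<otimes> l x \<otimes> inv (k x) \<otimes> inv (h x) \<in> W"
      by (rule proper_relation_group.invariant_approximation
          [OF proper_relation_group_Rs kcont kinv hcont W(1,2)])
    have lc: "l x \<in> carrier A" if "x \<in> topspace X" for x
      using l(2) that by blast
    have l_eq: "l x = l y" if "(x, y) \<in> Rs n" for x y
      using l(3) that by blast
    define h' where "h' x = h x \<otimes> l x" for x
    have "locally_constant X h'"
      unfolding h'_def
      by (rule locally_constant_determined[OF locally_constant_Pair[OF _ l(1)], of h])
        (use h in \<open>simp_all add: P_def\<close>)
    then have "P h'"
      using hc lc by (simp add: P_def h'_def)
    moreover have "Q n h h'"
      unfolding Q_def
    proof (intro conjI allI ballI impI)
      fix x y assume xy: "(x, y) \<in> Rs n"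
      then have xX: "x \<in> topspace X" "y \<in> topspace X"
        using Rs_in_topspace[OF xy] by auto
      show "h' x \<otimes> inv (h' y) = h x \<otimes> inv (h y)"
        unfolding h'_def l_eq[OF xy] using hc[OF xX(1)] hc[OF xX(2)] lc[OF xX(2)]
        by (simp add: group_word_simps)
    next
      fix x assume x: "x \<in> topspace X"
      have "(h' x \<otimes> inv (g (Suc n) x)) \<otimes> inv (h x \<otimes> inv (g n x)) =
          h x \<otimes> l x \<otimes> inv (k x) \<otimes> inv (h x)"
        using hc[OF x] lc[OF x] gc[OF x] by (simp add: h'_def k_def group_word_simps)
      then show "(h' x \<otimes> inv (g (Suc n) x)) \<otimes> inv (h x \<otimes> inv (g n x)) \<in> V (Suc n)"
        using l(4) x W(3) by auto
    qed
    ultimately show "\<exists>h'. P h' \<and> Q n h h'"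
      by blast
  qed
  then obtain h where h: "\<And>n. P (h n)" "\<And>n. Q n (h n) (h (Suc n))"
    by blast
  have hl: "locally_constant X (h n)" and hc: "\<And>x. x \<in> topspace X \<Longrightarrow> h n x \<in> carrier A" for n
    using h(1)[of n] by (simp_all add: P_def)
  have h_step: "h (Suc n) x \<otimes> inv (h (Suc n) y) = h n x \<otimes> inv (h n y)" if "(x, y) \<in> Rs n" for n x y
    using h(2)[of n] that unfolding Q_def by blast
  have h_const: "h m x \<otimes> inv (h m y) = h n x \<otimes> inv (h n y)" if "(x, y) \<in> Rs n" "n \<le> m" for m n x y
    using that(2)
  proof (induction rule: dec_induct)
    case (step k)
    have "(x, y) \<in> Rs k"
      using that(1) Rs_mono[OF step.hyps(1)] by blast
    then show ?case
      using h_step[of x y k] step.IH by simp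
  qed simp
  define \<psi> where "\<psi> n x = h n x \<otimes> inv (g n x)" for n x
  have \<psi>_cont: "continuous_map X T (\<psi> n)" for n
    unfolding \<psi>_def
    by (intro continuous_map_mult continuous_map_inv g locally_constant_imp_continuous_map hl)
      (simp add: hc topspace_T)
  have \<psi>c: "\<psi> n x \<in> carrier A" if "x \<in> topspace X" for n x
    using continuous_map_carrier[OF \<psi>_cont that] .
  have \<psi>_step: "\<psi> (Suc n) x \<otimes> inv (\<psi> n x) \<in> V (Suc n)" if "x \<in> topspace X" for n x
    using h(2)[of n] that unfolding Q_def \<psi>_def by blast
  have "\<exists>a. a \<in> carrier A \<and> (\<forall>n. a \<otimes> inv (\<psi> n x) \<in> V n)" if x: "x \<in> topspace X" for x
    using pointwise_limit[of "\<lambda>n. \<psi> n x"] \<psi>c[OF x] \<psi>_step[OF x] by metis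
  then obtain a where a: "\<And>x. x \<in> topspace X \<Longrightarrow> a x \<in> carrier A"
      "\<And>n x. x \<in> topspace X \<Longrightarrow> a x \<otimes> inv (\<psi> n x) \<in> V n"
    by metis
  have conj: "a x \<otimes> c (x, y) \<otimes> inv (a y) = h n x \<otimes> inv (h n y)" if xy: "(x, y) \<in> Rs n" for n x y
  proof -
    have xX: "x \<in> topspace X" "y \<in> topspace X"
      using Rs_in_topspace[OF xy] by auto
    show ?thesis
    proof (rule conjugate_limit)
      show "c (x, y) \<in> carrier A"
        using cocycle_closed[OF cocycle_restrict[OF c] xy] .
      show "h n x \<otimes> inv (h n y) \<in> carrier A"
        using hc xX by simp
      show "\<psi> m x \<otimes> c (x, y) \<otimes> inv (\<psi> m y) = h n x \<otimes> inv (h n y)" if "m \<ge> n" for m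
      proof -
        have "(x, y) \<in> Rs m"
          using xy Rs_mono[OF that] by blast
        then have "\<psi> m x \<otimes> c (x, y) \<otimes> inv (\<psi> m y) = h m x \<otimes> inv (h m y)"
          using hc[OF xX(1), of m] hc[OF xX(2), of m] gc[OF xX(1), of m] gc[OF xX(2), of m]
          by (simp add: \<psi>_def g(2)[of x y m] group_word_simps)
        then show ?thesis
          using h_const[OF xy that] by simp
      qed
    qed (use a \<psi>c xX in auto)
  qed
  show ?thesis
  proof (rule that[of a])
    show "continuous_map X T a"
      using \<psi>_cont a by (rule uniform_limit_continuous)
    show "finite ((\<lambda>(x, y). a x \<otimes> c (x, y) \<otimes> inv (a y)) ` Rs n)" for n
    proof (rule finite_subset)
      show "finite ((\<lambda>(s, t). s \<otimes> inv t) ` (h n ` topspace X \<times> h n ` topspace X))"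
        using finite_image_locally_constant[OF compact hl] by blast
      show "(\<lambda>(x, y). a x \<otimes> c (x, y) \<otimes> inv (a y)) ` Rs n \<subseteq>
          (\<lambda>(s, t). s \<otimes> inv t) ` (h n ` topspace X \<times> h n ` topspace X)"
      proof (intro image_subsetI)
        fix z assume z: "z \<in> Rs n"
        then obtain x y where xy: "z = (x, y)" "(x, y) \<in> Rs n"
          by (cases z) simp
        then show "(\<lambda>(x, y). a x \<otimes> c (x, y) \<otimes> inv (a y)) z \<in>
            (\<lambda>(s, t). s \<otimes> inv t) ` (h n ` topspace X \<times> h n ` topspace X)"
          using conj[OF xy(2)] Rs_in_topspace[OF xy(2)]
          by (intro image_eqI[of _ _ "(h n x, h n y)"]) auto
      qed
    qed
  qed
qed

end

section \<open>AF equivalence relations on compact spaces\<close>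

lemma (in AF_sequence) quasi_product_model:
  assumes sc: "second_countable X" and c: "c \<in> cocycles (\<Union>n. Rs n) A"
    and cont: "\<And>n. continuous_map (subtopology (prod_topology X X) (Rs n)) T c"
    and fin: "\<And>n. finite (c ` Rs n)"
  obtains G :: "(nat, nat) pre_digraph" and lev \<phi>
  where "bratteli_model X (\<Union>n. Rs n) G lev \<phi>"
    "quasi_product_cocycle G lev A T (c \<circ> inv_into (\<Union>n. Rs n) (map_prod \<phi> \<phi>))"
proof -
  have lc: "locally_constant (subtopology (prod_topology X X) (Rs n)) c" for n
    using continuous_finite_imp_locally_constant[OF cont Hausdorff_T] fin[of n]
    unfolding proper_relation.topspace_graph[OF proper_relation_Rs] .
  have diag: "c (x, x) = \<one>" if "x \<in> topspace X" for x
  proof (rule cocycle_diagonal[OF is_group c])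
    show "(x, x) \<in> (\<Union>n. Rs n)"
      using proper_relation.refl[OF proper_relation_Rs that] by blast
  qed
  have diag_eq: "c (x, x) = c (y, y)" if "x \<in> topspace X" "y \<in> topspace X" for x y
    using diag[OF that(1)] diag[OF that(2)] by simp
  obtain p where p: "tower_sequence X (level_relation X Rs) p"
      "\<forall>n. adapted (topspace X) (level_relation X Rs n) c (p n)"
    using tower_sequence_exists[OF sc Rs_proper Rs_incseq lc diag_eq] by blast
  have Union: "(\<Union>n. level_relation X Rs n) = (\<Union>n. Rs n)"
  proof
    show "(\<Union>n. level_relation X Rs n) \<subseteq> (\<Union>n. Rs n)"
    proof (intro UN_least)
      fix n show "level_relation X Rs n \<subseteq> (\<Union>n. Rs n)"
        using proper_relation.refl[OF proper_relation_Rs] by (cases n) auto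
    qed
    show "(\<Union>n. Rs n) \<subseteq> (\<Union>n. level_relation X Rs n)"
      using level_relation_simps(2)[of X Rs] by (intro UN_least) (metis UNIV_I UN_upper)
  qed
  interpret tower_sequence X "level_relation X Rs" p
    by (fact p(1))
  interpret tower_cocycle X "level_relation X Rs" p A c
    by unfold_locales (use c p(2) in \<open>simp_all add: Union\<close>)
  show ?thesis
    using bratteli_model_path quasi_product_cocycle_path[OF topspace_T] unfolding Union
    by (rule that)
qed

theorem theorem3p1:
  fixes X :: "'a topology" and R :: "('a \<times> 'a) set" and \<tau> :: "('a \<times> 'a) topology"
    and A :: "('g, 'm) monoid_scheme" and T :: "'g topology"
  assumes AF: "AF_equivalence X R \<tau>"
    and X: "compact_space X"
    and A: "locally_compact_group A T"
  shows
    "(\<exists>(G :: (nat, nat) pre_digraph) lev \<phi>. bratteli_model X R G lev \<phi>)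
     \<and>
     (\<forall>c Rs. c \<in> cocycles R A \<longrightarrow> continuous_map \<tau> T c \<longrightarrow>
        defining_sequence X R \<tau> Rs \<longrightarrow> (\<forall>n. finite (c ` Rs n)) \<longrightarrow>
        (\<exists>(G :: (nat, nat) pre_digraph) lev \<phi>.
           bratteli_model X R G lev \<phi> \<and>
           quasi_product_cocycle G lev A T (c \<circ> inv_into R (map_prod \<phi> \<phi>))))
     \<and>
     (first_countable T \<longrightarrow>
       (\<forall>Rs c. defining_sequence X R \<tau> Rs \<longrightarrow> c \<in> cocycles R A \<longrightarrow> continuous_map \<tau> T c \<longrightarrow>
         (\<exists>c'. c' \<in> cocycles R A \<and> continuous_map \<tau> T c' \<and>
            continuously_cohomologous X R A T c c' \<and> (\<forall>n. finite (c' ` Rs n)))))"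
proof -
  have lc: "lc_group A T"
    using A by unfold_locales
  have tau: "\<tau> = inductive_limit_topology X Rs" and R: "R = (\<Union>n. Rs n)"
    and AFs: "AF_sequence X A T Rs" if "defining_sequence X R \<tau> Rs" for Rs
  proof -
    show "\<tau> = inductive_limit_topology X Rs" "R = (\<Union>n. Rs n)"
      using that by (auto simp: defining_sequence_def)
    have "stone_space X"
      using AF X by unfold_locales (auto simp: AF_equivalence_def AP_equivalence_def)
    then show "AF_sequence X A T Rs"
      using lc that by (auto simp: AF_sequence_def AF_sequence_axioms_def defining_sequence_def)
  qed
  have sc: "second_countable X"
    using AF by (simp add: AF_equivalence_def AP_equivalence_def)
  have cont_iff: "continuous_map \<tau> T c \<longleftrightarrow>
      (\<forall>n. continuous_map (subtopology (prod_topology X X) (Rs n)) T c)"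
    if Rs: "defining_sequence X R \<tau> Rs" for c Rs
    unfolding tau[OF Rs]
    by (intro continuous_map_inductive_limit proper_relation.graph_subset
        AF_sequence.proper_relation_Rs[OF AFs[OF Rs]])
  have model: "\<exists>(G :: (nat, nat) pre_digraph) lev \<phi>. bratteli_model X R G lev \<phi> \<and>
      quasi_product_cocycle G lev A T (c \<circ> inv_into R (map_prod \<phi> \<phi>))"
    if c: "c \<in> cocycles R A" and cont: "continuous_map \<tau> T c"
      and Rs: "defining_sequence X R \<tau> Rs" and fin: "\<forall>n. finite (c ` Rs n)" for c Rs
  proof -
    interpret AF_sequence X A T Rs
      by (rule AFs[OF Rs])
    have cont_n: "continuous_map (subtopology (prod_topology X X) (Rs n)) T c" for n
      using cont cont_iff[OF Rs] by blast
    have fin_n: "finite (c ` Rs n)" for n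
      using fin by blast
    obtain G :: "(nat, nat) pre_digraph" and lev \<phi>
      where "bratteli_model X (\<Union>n. Rs n) G lev \<phi>"
        "quasi_product_cocycle G lev A T (c \<circ> inv_into (\<Union>n. Rs n) (map_prod \<phi> \<phi>))"
      by (rule quasi_product_model[OF sc c[unfolded R[OF Rs]] cont_n fin_n])
    then show ?thesis
      unfolding R[OF Rs] by blast
  qed
  have "\<exists>(G :: (nat, nat) pre_digraph) lev \<phi>. bratteli_model X R G lev \<phi>"
  proof -
    obtain Rs where Rs: "defining_sequence X R \<tau> Rs"
      using AF unfolding AF_equivalence_def AP_equivalence_def by blast
    interpret AF_sequence X A T Rs
      by (rule AFs[OF Rs])
    \<comment> \<open>The diagram for the trivial cocycle.\<close>
    let ?c = "\<lambda>_ :: 'a \<times> 'a. \<one>\<^bsub>A\<^esub>"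
    have "?c \<in> cocycles R A"
      by (simp add: cocycles_def)
    moreover have "continuous_map \<tau> T ?c"
      by (intro continuous_map_carrier_const one_closed)
    moreover have "\<forall>n. finite (?c ` Rs n)"
      by (auto intro: finite_subset[of _ "{\<one>\<^bsub>A\<^esub>}"])
    ultimately show ?thesis
      using model[OF _ _ Rs, of ?c] by blast
  qed
  moreover have "\<exists>c'. c' \<in> cocycles R A \<and> continuous_map \<tau> T c' \<and>
      continuously_cohomologous X R A T c c' \<and> (\<forall>n. finite (c' ` Rs n))"
    if fc: "first_countable T" and Rs: "defining_sequence X R \<tau> Rs" and c: "c \<in> cocycles R A"
      and cont: "continuous_map \<tau> T c" for Rs c
  proof -
    interpret AF_sequence X A T Rs
      by (rule AFs[OF Rs])
    have cont_n: "continuous_map (subtopology (prod_topology X X) (Rs n)) T c" for n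
      using cont cont_iff[OF Rs] by blast
    obtain \<psi> where \<psi>: "continuous_map X T \<psi>"
        "\<forall>n. finite ((\<lambda>(x, y). \<psi> x \<otimes>\<^bsub>A\<^esub> c (x, y) \<otimes>\<^bsub>A\<^esub> inv\<^bsub>A\<^esub> (\<psi> y)) ` Rs n)"
      using finite_valued_cohomologous[OF fc c[unfolded R[OF Rs]] cont_n] by blast
    let ?c = "\<lambda>(x, y). \<psi> x \<otimes>\<^bsub>A\<^esub> c (x, y) \<otimes>\<^bsub>A\<^esub> inv\<^bsub>A\<^esub> (\<psi> y)"
    have R_in: "x \<in> topspace X \<and> y \<in> topspace X" if "(x, y) \<in> R" for x y
      using that Rs_in_topspace unfolding R[OF Rs] by blast
    have \<psi>c: "\<psi> x \<in> carrier A" if "x \<in> topspace X" for x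
      by (rule continuous_map_carrier[OF \<psi>(1) that])
    have "?c \<in> cocycles R A"
      unfolding cocycles_def
    proof (intro CollectI conjI allI impI)
      show "?c \<in> R \<rightarrow> carrier A"
      proof
        fix z assume "z \<in> R"
        then obtain x y where xy: "z = (x, y)" "(x, y) \<in> R"
          by (cases z) simp
        show "?c z \<in> carrier A"
          using R_in[OF xy(2)] \<psi>c cocycle_closed[OF c xy(2)] by (simp add: xy(1))
      qed
    next
      fix x y z assume xy: "(x, y) \<in> R" and yz: "(y, z) \<in> R"
      have "\<psi> x \<in> carrier A" "\<psi> y \<in> carrier A" "\<psi> z \<in> carrier A"
        using R_in[OF xy] R_in[OF yz] \<psi>c by auto
      then show "?c (x, y) \<otimes>\<^bsub>A\<^esub> ?c (y, z) = ?c (x, z)"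
        using cocycle_closed[OF c xy] cocycle_closed[OF c yz]
        by (simp add: cocycle_mult[OF c xy yz, symmetric] group_word_simps)
    qed
    moreover have "continuous_map \<tau> T ?c"
      unfolding cont_iff[OF Rs]
    proof
      fix n
      interpret proper_relation X "Rs n"
        by (rule proper_relation_Rs)
      have "continuous_map graph_topology T (\<lambda>z. \<psi> (fst z) \<otimes>\<^bsub>A\<^esub> c z \<otimes>\<^bsub>A\<^esub> inv\<^bsub>A\<^esub> (\<psi> (snd z)))"
        by (intro continuous_map_mult continuous_map_inv cont_n
            continuous_map_compose[OF continuous_map_graph(1) \<psi>(1), unfolded o_def]
            continuous_map_compose[OF continuous_map_graph(2) \<psi>(1), unfolded o_def])
      then show "continuous_map graph_topology T ?c"
        by (simp add: case_prod_beta')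
    qed
    moreover have "continuously_cohomologous X R A T c ?c"
      unfolding continuously_cohomologous_def using \<psi>(1) by auto
    ultimately show ?thesis
      using \<psi>(2) by blast
  qed
  ultimately show ?thesis
    using model by blast
qed

end
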